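(* Let $R(q)=\dfrac{(q;q^5)_\infty(q^4;q^5)_\infty}{(q^2;q^5)_\infty(q^3;q^5)_\infty}$ and define integers $A(n)$ by the power series expansion $\dfrac{1}{R^5(q)}=\sum_{n=0}^{\infty}A(n)q^{n}$. Then for all nonnegative integers $n$, $$A(5n+1)>0,\quad A(5n+2)>0,\quad A(5n+3)>0,\quad A(5n+4)<0.$$
   Context: For complex $a,q$ with $|q|<1$, $(a;q)_\infty:=\prod_{k=0}^{\infty}(1-aq^k)$. All series are formal power series in $q$ (convergent for $|q|<1$). $R(q)$ equals $q^{-1/5}$ times the Rogers–Ramanujan continued fraction. *)

theory Defs
  imports "HOL-Complex_Analysis.Complex_Analysis"
begin

definition qpoch_inf :: "complex \<Rightarrow> complex \<Rightarrow> complex" where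
  "qpoch_inf a q = (\<Prod>k. 1 - a * q ^ k)"

definition rr_R :: "complex \<Rightarrow> complex" where
  "rr_R q = (qpoch_inf q (q ^ 5) * qpoch_inf (q ^ 4) (q ^ 5)) /
            (qpoch_inf (q ^ 2) (q ^ 5) * qpoch_inf (q ^ 3) (q ^ 5))"

text \<open>
  Existence and uniqueness of the integer sequence described here are proved
  below (\<open>rr_A_ex1\<close>), so the definite description is well-defined.
\<close>
definition rr_A :: "nat \<Rightarrow> int" where
  "rr_A = (THE A. \<forall>q. norm q < 1 \<longrightarrow> (\<lambda>n. of_int (A n) * q ^ n) sums (1 / rr_R q ^ 5))"

lemma fps_mult_Ints:
  fixes F G :: "complex fps"
  assumes "\<And>n. fps_nth F n \<in> \<int>" "\<And>n. fps_nth G n \<in> \<int>"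
  shows "fps_nth (F * G) n \<in> \<int>"
  unfolding fps_mult_nth by (intro Ints_sum Ints_mult assms)

lemma fps_power_Ints:
  fixes F :: "complex fps"
  assumes "\<And>n. fps_nth F n \<in> \<int>"
  shows "fps_nth (F ^ k) n \<in> \<int>"
proof (induction k arbitrary: n)
  case 0
  show ?case by simp
next
  case (Suc k)
  show ?case unfolding power_Suc by (intro fps_mult_Ints assms Suc.IH)
qed

lemma fps_inverse_Ints:
  fixes F :: "complex fps"
  assumes "\<And>n. fps_nth F n \<in> \<int>" "fps_nth F 0 = 1"
  shows "fps_nth (inverse F) n \<in> \<int>"
proof (induction n rule: less_induct)
  case (less n)
  show ?case
  proof (cases n)
    case 0
    thus ?thesis by (simp add: assms)
  next
    case (Suc m)
    have "(\<Sum>i = 1..n. fps_nth F i * fps_nth (inverse F) (n - i)) \<in> \<int>"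
      using less by (intro Ints_sum Ints_mult assms) auto
    moreover have "fps_nth (F * inverse F) n = 0"
      using Suc by (subst inverse_mult_eq_1') (auto simp: assms)
    hence "fps_nth (inverse F) n = - (\<Sum>i = 1..n. fps_nth F i * fps_nth (inverse F) (n - i))"
      by (simp add: fps_mult_nth sum.atLeast_Suc_atMost assms eq_neg_iff_add_eq_0)
    ultimately show ?thesis by simp
  qed
qed

lemma qpoch_inf_power:
  fixes m :: nat
  assumes m: "m > 0"
  defines "g \<equiv> \<lambda>q. qpoch_inf (q ^ m) (q ^ 5)"
  shows "g holomorphic_on ball 0 1"
    and "\<And>q. norm q < 1 \<Longrightarrow> g q \<noteq> 0"
    and "g has_fps_expansion fps_expansion g 0"
    and "fps_nth (fps_expansion g 0) n \<in> \<int>"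
    and "fps_nth (fps_expansion g 0) 0 = 1"
proof -
  define f where "f = (\<lambda>k (q::complex). 1 - q ^ m * (q ^ 5) ^ k)"
  have g_eq: "g q = (\<Prod>k. f k q)" for q
    by (simp add: g_def f_def qpoch_inf_def)
  have bound: "norm (f k q - 1) \<le> r ^ k" if "norm q \<le> r" "r < 1" for k q r
  proof -
    have "0 \<le> r" using that(1) norm_ge_zero order_trans by blast
    have "norm (f k q - 1) = norm q ^ (m + 5 * k)"
      by (simp add: f_def norm_mult norm_power power_add power_mult)
    also have "\<dots> \<le> r ^ (m + 5 * k)"
      using that by (intro power_mono) auto
    also have "\<dots> \<le> r ^ k"
      using that \<open>0 \<le> r\<close> by (intro power_decreasing) auto
    finally show ?thesis .
  qed
  have conv: "convergent_prod (\<lambda>k. f k q)" if "norm q < 1" for q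
  proof -
    have "summable (\<lambda>k. norm (f k q - 1))"
      using that
      by (intro summable_comparison_test'[OF summable_geometric[of "norm q"]])
         (auto intro!: bound)
    thus ?thesis
      by (intro abs_convergent_prod_imp_convergent_prod summable_imp_abs_convergent_prod)
  qed
  have nz: "f k q \<noteq> 0" if "norm q < 1" for k q
  proof
    assume "f k q = 0"
    hence "q ^ (m + 5 * k) = 1"
      by (simp add: f_def power_add power_mult)
    hence "norm q ^ (m + 5 * k) = 1"
      by (metis norm_one norm_power)
    moreover have "norm q ^ (m + 5 * k) < 1"
      using that m by (simp add: power_less_one_iff)
    ultimately show False by simp
  qed
  show nz': "g q \<noteq> 0" if "norm q < 1" for q
    unfolding g_eq using that by (intro prodinf_nonzero conv nz)
  have ulim: "uniform_limit (cball 0 r) (\<lambda>N q. \<Prod>k<N. f k q) g sequentially" if r: "r < 1" for r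
  proof -
    have "uniformly_convergent_on (cball 0 r) (\<lambda>N q. \<Sum>k<N. norm (f k q - 1))"
    proof (cases "r < 0")
      case False
      thus ?thesis
        using r by (intro Weierstrass_m_test'[where M = "\<lambda>k. r ^ k"])
                   (auto intro!: bound summable_geometric)
    qed (auto simp: uniformly_convergent_on_def)
    hence "uniformly_convergent_on (cball 0 r) (\<lambda>N q. \<Prod>k<N. f k q)"
      by (intro uniformly_convergent_on_prod') (auto simp: f_def intro!: continuous_intros)
    hence *: "uniform_limit (cball 0 r) (\<lambda>N q. \<Prod>k<N. f k q)
             (\<lambda>q. lim (\<lambda>N. \<Prod>k<N. f k q)) sequentially"
      by (simp add: uniformly_convergent_uniform_limit_iff)
    have "lim (\<lambda>N. \<Prod>k<N. f k q) = g q" if "q \<in> cball 0 r" for q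
      unfolding g_eq using that r
      by (intro prodinf_eq_lim'[symmetric] conv nz) auto
    hence "uniform_limit (cball 0 r) (\<lambda>N q. \<Prod>k<N. f k q)
             (\<lambda>q. lim (\<lambda>N. \<Prod>k<N. f k q)) sequentially \<longleftrightarrow> ?thesis"
      by (intro uniform_limit_cong') auto
    with * show ?thesis by simp
  qed
  have f_holo: "(\<lambda>q. \<Prod>k<N. f k q) holomorphic_on A" for N A
    unfolding f_def by (intro holomorphic_intros)
  show holo: "g holomorphic_on ball 0 1"
  proof (rule holomorphic_uniform_sequence[of _ "\<lambda>N q. \<Prod>k<N. f k q"])
    fix x :: complex
    assume x: "x \<in> ball 0 1"
    define d where "d = (1 - norm x) / 2"
    have d: "d > 0" "norm x + d < 1"
      using x by (auto simp: d_def field_simps)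
    have sub: "cball x d \<subseteq> cball 0 (norm x + d)"
      by (simp add: subset_iff) (metis add.commute add_le_cancel_left dist_norm norm_minus_commute
            norm_triangle_sub order_trans)
    have "uniform_limit (cball x d) (\<lambda>N q. \<Prod>k<N. f k q) g sequentially"
      by (rule uniform_limit_on_subset[OF ulim[OF d(2)] sub])
    moreover have "cball x d \<subseteq> ball 0 1"
      using sub d(2) by force
    ultimately show "\<exists>d>0. cball x d \<subseteq> ball 0 1 \<and>
        uniform_limit (cball x d) (\<lambda>N q. \<Prod>k<N. f k q) g sequentially"
      using d(1) by blast
  qed (auto intro: f_holo)
  show exp: "g has_fps_expansion fps_expansion g 0"
    using holo by (intro has_fps_expansion_fps_expansion[of "ball 0 1"]) auto
  show "fps_nth (fps_expansion g 0) n \<in> \<int>"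
  proof -
    define F :: "nat \<Rightarrow> complex fps"
      where "F = (\<lambda>N. \<Prod>k<N. 1 - fps_X ^ m * (fps_X ^ 5) ^ k)"
    have F: "(\<lambda>q. \<Prod>k<N. f k q) has_fps_expansion F N" for N
      unfolding F_def f_def by (intro fps_expansion_intros)
    have F_Ints: "fps_nth (F N) n \<in> \<int>" for N n
    proof (induction N arbitrary: n)
      case 0
      show ?case by (simp add: F_def)
    next
      case (Suc N)
      have "fps_nth (1 - fps_X ^ m * (fps_X ^ 5) ^ N :: complex fps) n \<in> \<int>" for n
        by (simp flip: power_mult power_add)
      moreover have "F (Suc N) = F N * (1 - fps_X ^ m * (fps_X ^ 5) ^ N)"
        by (simp add: F_def)
      ultimately show ?case
        using Suc.IH by (simp only:) (rule fps_mult_Ints)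
    qed
    have "(\<lambda>N. (deriv ^^ n) (\<lambda>q. \<Prod>k<N. f k q) 0) \<longlonglongrightarrow> (deriv ^^ n) g 0"
    proof (rule higher_deriv_complex_uniform_limit[where A = "ball 0 (1/2)"])
      show "uniform_limit (ball 0 (1/2)) (\<lambda>N q. \<Prod>k<N. f k q) g sequentially"
        by (rule uniform_limit_on_subset[OF ulim[of "1/2"]]) auto
    qed (auto intro!: always_eventually f_holo)
    hence "(\<lambda>N. (deriv ^^ n) (\<lambda>q. \<Prod>k<N. f k q) 0 / fact n) \<longlonglongrightarrow> (deriv ^^ n) g 0 / fact n"
      by (intro tendsto_intros) auto
    hence "(\<lambda>N. fps_nth (F N) n) \<longlonglongrightarrow> fps_nth (fps_expansion g 0) n"
      by (simp add: fps_nth_fps_expansion[OF F] fps_nth_fps_expansion[OF exp])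
    thus ?thesis
      by (rule closed_sequentially[OF closed_Ints F_Ints])
  qed
  show "fps_nth (fps_expansion g 0) 0 = 1"
    using m by (simp add: fps_expansion_def g_eq f_def zero_power)
qed

lemma rr_A_ex1:
  "\<exists>!A. \<forall>q. norm q < 1 \<longrightarrow> (\<lambda>n. of_int (A n) * q ^ n) sums (1 / rr_R q ^ 5)"
proof (rule ex_ex1I)
  define g where "g = (\<lambda>m q. qpoch_inf (q ^ m) (q ^ 5))"
  define G where "G = (\<lambda>m. fps_expansion (g m) 0)"
  define h where "h = (\<lambda>q. (g 2 q * g 3 q * (inverse (g 1 q) * inverse (g 4 q))) ^ 5)"
  define H where "H = (G 2 * G 3 * (inverse (G 1) * inverse (G 4))) ^ 5"
  have g_app: "g m = (\<lambda>q. qpoch_inf (q ^ m) (q ^ 5))" for m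
    by (simp add: g_def)
  note g = qpoch_inf_power[folded g_app]
  have g_exp: "(\<lambda>q. g m q) has_fps_expansion G m" if "m > 0" for m
    using g(3)[OF that] by (simp add: G_def)
  have G_Ints: "fps_nth (G m) n \<in> \<int>" and G_0: "fps_nth (G m) 0 = 1" if "m > 0" for m n
    using g(4,5)[OF that] by (auto simp: G_def)
  have h_eq: "h q = 1 / rr_R q ^ 5" for q
    by (simp add: h_def rr_R_def g_def field_simps)
  have g_nz: "g m q \<noteq> 0" if "m > 0" "norm q < 1" for m q
    using qpoch_inf_power(2)[OF that] by (simp add: g_def)
  have g_holo: "(\<lambda>q. g m q) holomorphic_on ball 0 1" if "m > 0" for m
    using g(1)[OF that] by simp
  have holo: "h holomorphic_on ball 0 1"
    unfolding h_def by (intro holomorphic_intros g_holo) (use g_nz in auto)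
  have exp: "h has_fps_expansion H"
    unfolding h_def H_def by (intro fps_expansion_intros g_exp) (auto simp: G_0)
  have "fps_nth H n \<in> \<int>" for n
    unfolding H_def
    by (intro fps_power_Ints fps_mult_Ints fps_inverse_Ints G_Ints G_0) auto
  then obtain A where A: "\<And>n. fps_nth H n = of_int (A n)"
    unfolding Ints_def by (auto simp: image_iff) metis
  have "(\<lambda>n. of_int (A n) * q ^ n) sums (1 / rr_R q ^ 5)" if "norm q < 1" for q
    using has_fps_expansion_imp_sums_complex[OF exp, of 1 q] holo that
    by (simp add: A h_eq one_ereal_def)
  thus "\<exists>A. \<forall>q. norm q < 1 \<longrightarrow> (\<lambda>n. of_int (A n) * q ^ n) sums (1 / rr_R q ^ 5)"
    by blast
next
  fix A B :: "nat \<Rightarrow> int"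
  have *: "(\<lambda>q. 1 / rr_R q ^ 5) has_fps_expansion Abs_fps (\<lambda>n. of_int (C n))"
    if "\<forall>q. norm q < 1 \<longrightarrow> (\<lambda>n. of_int (C n) * q ^ n) sums (1 / rr_R q ^ 5)" for C
  proof (rule has_fps_expansionI)
    have "eventually (\<lambda>q::complex. q \<in> ball 0 1) (nhds 0)"
      by (intro eventually_nhds_in_open) auto
    thus "\<forall>\<^sub>F q in nhds 0. (\<lambda>n. fps_nth (Abs_fps (\<lambda>n. of_int (C n))) n * q ^ n)
            sums (1 / rr_R q ^ 5)"
      by eventually_elim (use that in auto)
  qed
  assume "\<forall>q. norm q < 1 \<longrightarrow> (\<lambda>n. of_int (A n) * q ^ n) sums (1 / rr_R q ^ 5)"
         "\<forall>q. norm q < 1 \<longrightarrow> (\<lambda>n. of_int (B n) * q ^ n) sums (1 / rr_R q ^ 5)"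
  from fps_expansion_unique_complex[OF this[THEN *]] show "A = B"
    by (auto simp: fps_eq_iff fun_eq_iff)
qed

lemma rr_A_sums:
  assumes "norm q < 1"
  shows "(\<lambda>n. of_int (rr_A n) * q ^ n) sums (1 / rr_R q ^ 5)"
  using theI'[OF rr_A_ex1] assms unfolding rr_A_def by blast

end

theory Submission
  imports Defs "HOL-Library.Nat_Bijection" "HOL-Real_Asymp.Real_Asymp"
begin

text \<open>
  Put G = 1 / ((q;q^5) (q^4;q^5)) and H = 1 / ((q^2;q^5) (q^3;q^5)), so that R = H / G, and write
  g, h for G, H at q^5.

  By the Jacobi triple product, 1 / G and 1 / H are theta functions up to the factor (q^5;q^5).
  Comparing the double series of their product with a sum over a sublattice of index 5 gives
  G H (g^2 - q g h - q^2 h^2) = 1. The product of this identity over the five conjugates of q is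
  Ramanujan's G^11 H - 11 q G^6 H^6 - q^2 G H^11 = 1. Both identities together give a quadratic
  equation for 1 / R^5 over the functions of q^5 and q, whose solution is a polynomial
  g^12 S(q h / g) with S of degree 10; this is the 5-dissection of 1 / R^5.

  The components of the dissection are 5 (G^11 H - 8 q G^6 H^6) = 5 (1 + 3 q G^6 H^6 + q^2 G H^11),
  10 G^5 H^2 Z, 5 G^4 H^3 Z with Z = G^5 - 3 q H^5, and -5 (3 G^8 H^4 + q G^3 H^9). Hence the
  theorem follows once Z is seen to have nonnegative coefficients.
\<close>

text \<open>Strictness of the inequalities comes from comparison with 1 / (1 - q), all of whose
  coefficients are 1: up to sign and a constant factor, each component with a prescribed sign
  dominates this series coefficientwise. The obstacle in Z is that G^5 and 3 q H^5 cannot be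
  compared factor by factor. With the exponents below 5 removed, G no longer dominates H: the
  coefficient of q^7 is 0 in the one and 1 in the other. The difference becomes nonnegative only
  after multiplication by 1 / ((1 - q) (1 - q^2)), which the exponent 1 in G^5 can supply; the
  coefficient 3 is absorbed by a separate inequality that involves the exponents 1 to 4 alone.
  Identities are proved for complex functions, where conjugates of q and the choice of a root by
  continuity are available; signs are read off formal power series.\<close>

lemma qpoch_inf_convergent:
  fixes a Q :: complex
  assumes "norm Q < 1"
  shows "convergent_prod (\<lambda>k. 1 - a * Q ^ k)"
proof -
  have "summable (\<lambda>k. norm a * norm Q ^ k)"
    using assms by (intro summable_mult summable_geometric) auto
  thus ?thesis
    by (intro abs_convergent_prod_imp_convergent_prod summable_imp_abs_convergent_prod)
       (simp add: norm_mult norm_power)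
qed

lemma qpoch_inf_LIMSEQ:
  assumes "norm Q < 1"
  shows "(\<lambda>N. \<Prod>k<N. 1 - a * Q ^ k) \<longlonglongrightarrow> qpoch_inf a Q"
proof -
  have "(\<lambda>N. \<Prod>k\<le>N. 1 - a * Q ^ k) \<longlonglongrightarrow> qpoch_inf a Q"
    unfolding qpoch_inf_def by (intro convergent_prod_LIMSEQ qpoch_inf_convergent assms)
  hence "(\<lambda>N. \<Prod>k<Suc N. 1 - a * Q ^ k) \<longlonglongrightarrow> qpoch_inf a Q"
    by (simp only: lessThan_Suc_atMost)
  thus ?thesis by (rule LIMSEQ_imp_Suc)
qed

lemma one_minus_power_nonzero:
  fixes Q :: complex
  assumes "norm Q < 1" "n > 0"
  shows "1 - Q ^ n \<noteq> 0"
proof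
  assume "1 - Q ^ n = 0"
  hence "norm Q ^ n = 1" by (metis eq_iff_diff_eq_0 norm_one norm_power)
  moreover have "norm Q ^ n < 1" using assms by (simp add: power_less_one_iff)
  ultimately show False by simp
qed

lemma qpoch_inf_power_nonzero:
  assumes "norm q < 1" "m > 0" "d > 0"
  shows "qpoch_inf (q ^ m) (q ^ d) \<noteq> 0"
  unfolding qpoch_inf_def
proof (rule prodinf_nonzero)
  show "convergent_prod (\<lambda>k. 1 - q ^ m * (q ^ d) ^ k)"
    using assms by (intro qpoch_inf_convergent) (simp add: norm_power power_less_one_iff)
  show "1 - q ^ m * (q ^ d) ^ k \<noteq> 0" for k
    using one_minus_power_nonzero[of q "m + d * k"] assms by (simp add: power_add power_mult)
qed

section \<open>The Jacobi triple product\<close>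

text \<open>The q-Pascal rule avoids division, so the value makes sense even when some 1 - Q^i
  vanishes. For k > M the truncated exponent M - k is harmless, because the coefficient that it
  multiplies is 0.\<close>

fun gauss_binomial :: "complex \<Rightarrow> nat \<Rightarrow> nat \<Rightarrow> complex" where
  "gauss_binomial Q M 0 = 1"
| "gauss_binomial Q 0 (Suc k) = 0"
| "gauss_binomial Q (Suc M) (Suc k) =
     gauss_binomial Q M (Suc k) + Q ^ (M - k) * gauss_binomial Q M k"

lemma gauss_binomial_eq_0: "k > M \<Longrightarrow> gauss_binomial Q M k = 0"
  by (induction Q M k rule: gauss_binomial.induct) auto

text \<open>The quotient formula with denominators cleared. In the induction the two terms of the
  Pascal rule combine through (1 - Q^j) + Q^j (1 - Q^k) = 1 - Q^(j + k).\<close>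

lemma gauss_binomial_mult:
  "gauss_binomial Q (k + j) k * ((\<Prod>i<k. 1 - Q ^ Suc i) * (\<Prod>i<j. 1 - Q ^ Suc i)) =
     (\<Prod>i<k+j. 1 - Q ^ Suc i)"
proof (induction "k + j" arbitrary: k j)
  case 0
  thus ?case by simp
next
  case (Suc M)
  note IH = Suc(1)
  show ?case
  proof (cases k)
    case [simp]: (Suc k')
    show ?thesis
    proof (cases j)
      case 0
      have "gauss_binomial Q (k' + 0) k' * ((\<Prod>i<k'. 1 - Q ^ Suc i) * (\<Prod>i<0. 1 - Q ^ Suc i)) =
             (\<Prod>i<k'+0. 1 - Q ^ Suc i)"
        using Suc.hyps(2) 0 by (intro IH) auto
      thus ?thesis using 0 by (auto simp: gauss_binomial_eq_0)
    next
      case [simp]: (Suc j')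
      define A where "A = (\<lambda>n. \<Prod>i<n. 1 - Q ^ Suc i)"
      have A: "A (Suc n) = A n * (1 - Q ^ Suc n)" for n by (simp add: A_def)
      have 1: "gauss_binomial Q (Suc k' + j') (Suc k') * (A (Suc k') * A j') = A (Suc k' + j')"
        unfolding A_def using Suc.hyps(2) by (intro IH) auto
      have 2: "gauss_binomial Q (k' + Suc j') k' * (A k' * A (Suc j')) = A (k' + Suc j')"
        unfolding A_def using Suc.hyps(2) by (intro IH) auto
      have "gauss_binomial Q (k + j) k * (A k * A j) =
            gauss_binomial Q (Suc (k' + j')) (Suc k') * (A k * A j) +
            Q ^ Suc j' * gauss_binomial Q (Suc (k' + j')) k' * (A k * A j)"
        by (simp add: algebra_simps Suc_diff_le)
      also have "gauss_binomial Q (Suc (k' + j')) (Suc k') * (A k * A j) =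
                 A (Suc (k' + j')) * (1 - Q ^ Suc j')"
        using 1 by (simp add: A mult_ac)
      also have "Q ^ Suc j' * gauss_binomial Q (Suc (k' + j')) k' * (A k * A j) =
                 Q ^ Suc j' * (A (Suc (k' + j')) * (1 - Q ^ Suc k'))"
        using 2 by (simp add: A mult_ac)
      also have "A (Suc (k' + j')) * (1 - Q ^ Suc j') +
          Q ^ Suc j' * (A (Suc (k' + j')) * (1 - Q ^ Suc k')) = A (Suc (Suc (k' + j')))"
        by (simp add: A algebra_simps power_add)
      finally show ?thesis by (simp add: A_def)
    qed
  qed simp
qed

lemma gauss_binomial_theorem:
  "(\<Prod>k<M. 1 + x * Q ^ k) = (\<Sum>k\<le>M. Q ^ (k choose 2) * gauss_binomial Q M k * x ^ k)"
proof (induction M)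
  case 0
  show ?case by (simp add: numeral_2_eq_2)
next
  case (Suc M)
  define f where "f = (\<lambda>k. Q ^ (k choose 2) * gauss_binomial Q M k * x ^ k)"
  have step: "Q ^ (Suc k choose 2) * gauss_binomial Q (Suc M) (Suc k) * x ^ Suc k =
              f (Suc k) + x * Q ^ M * f k" if "k \<le> M" for k
  proof -
    have *: "Q ^ M = Q ^ k * Q ^ (M - k)" using that by (simp flip: power_add)
    show ?thesis
      unfolding f_def * by (simp add: numeral_2_eq_2 power_add algebra_simps)
  qed
  have "(\<Sum>k\<le>Suc M. Q ^ (k choose 2) * gauss_binomial Q (Suc M) k * x ^ k) =
        1 + (\<Sum>k\<le>M. f (Suc k) + x * Q ^ M * f k)"
    by (subst sum.atMost_Suc_shift) (use step in \<open>simp add: binomial_eq_0 del: gauss_binomial.simps(3) power_Suc cong: sum.cong_simp\<close>)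
  also have "1 + (\<Sum>k\<le>M. f (Suc k) + x * Q ^ M * f k) =
             (\<Sum>k\<le>Suc M. f k) + x * Q ^ M * (\<Sum>k\<le>M. f k)"
    by (subst sum.atMost_Suc_shift) (simp add: sum.distrib sum_distrib_left f_def numeral_2_eq_2)
  also have "(\<Sum>k\<le>Suc M. f k) = (\<Sum>k\<le>M. f k)"
    by (simp add: f_def gauss_binomial_eq_0)
  finally show ?case
    using Suc by (simp add: f_def algebra_simps)
qed

definition triangle :: "int \<Rightarrow> int" where
  "triangle n = n * (n - 1) div 2"

text \<open>Identities between exponents are proved below after doubling, where this leaves
  polynomial identities without division.\<close>

lemma two_triangle: "2 * triangle n = n * (n - 1)"
  unfolding triangle_def by simp

lemma triangle_plus1: "triangle (n + 1) = triangle n + n"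
  using two_triangle[of n] two_triangle[of "n + 1"] by (simp add: algebra_simps)

definition jacobi_term :: "complex \<Rightarrow> complex \<Rightarrow> int \<Rightarrow> complex" where
  "jacobi_term z Q n = (-z) powi n * Q powi (triangle n)"

text \<open>The central coefficients, indexed by all integers so that the finite identity can be
  compared termwise with the bilateral series. The cutoff is essential below -N, where
  \<open>nat\<close> would return 0 and the coefficient would be 1.\<close>

definition gauss_binomial_centred :: "complex \<Rightarrow> nat \<Rightarrow> int \<Rightarrow> complex" where
  "gauss_binomial_centred Q N n =
     (if \<bar>n\<bar> \<le> int N then gauss_binomial Q (2 * N) (nat (n + int N)) else 0)"

context
  fixes z Q :: complex
  assumes z: "z \<noteq> 0" and Q: "Q \<noteq> 0"
begin

lemma jacobi_term_0 [simp]: "jacobi_term z Q 0 = 1"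
  by (simp add: jacobi_term_def triangle_def)

lemma jacobi_term_plus1: "jacobi_term z Q (n + 1) = - z * Q powi n * jacobi_term z Q n"
  using z Q by (simp add: jacobi_term_def triangle_plus1 power_int_add)

lemma jacobi_term_uminus_Suc:
  "jacobi_term z Q (- int (Suc n)) = jacobi_term z Q (- int n) * (- (Q ^ Suc n / z))"
proof -
  have "jacobi_term z Q (- int n) = - z * Q powi (- int (Suc n)) * jacobi_term z Q (- int (Suc n))"
    using jacobi_term_plus1[of "- int (Suc n)"] by simp
  thus ?thesis
    using z Q by (simp add: power_int_minus field_simps del: power_Suc of_nat_Suc)
qed

text \<open>This is the q-binomial theorem with 2 N factors at x = - z / Q^N: the upper N factors
  are 1 - z Q^k, and the lower N factors involve negative powers of Q.\<close>

lemma jacobi_triple_product_finite: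
  "(\<Prod>k<N. 1 - z * Q ^ k) * (\<Prod>k<N. 1 - Q / z * Q ^ k) =
     (\<Sum>k\<le>2*N. jacobi_term z Q (int k - int N) * gauss_binomial Q (2 * N) k)"
proof -
  define x where "x = - z / Q ^ N"
  \<comment> \<open>The theta term at -n is exactly the monomial that turns the factors 1 - z / Q^(j
    + 1) into 1 - (Q / z) Q^j.\<close>
  have low: "jacobi_term z Q (- int n) * (\<Prod>j<n. 1 - z / Q ^ Suc j) = (\<Prod>k<n. 1 - Q / z * Q ^ k)" for n
  proof (induction n)
    case (Suc n)
    have "- (Q ^ Suc n / z) * (1 - z / Q ^ Suc n) = 1 - Q / z * Q ^ n"
      using z Q by (simp add: field_simps)
    moreover have "jacobi_term z Q (- int (Suc n)) * (\<Prod>j<Suc n. 1 - z / Q ^ Suc j) =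
        (jacobi_term z Q (- int n) * (\<Prod>j<n. 1 - z / Q ^ Suc j)) *
        (- (Q ^ Suc n / z) * (1 - z / Q ^ Suc n))"
      unfolding jacobi_term_uminus_Suc prod.lessThan_Suc by (simp only: mult_ac)
    ultimately show ?case by (simp only: Suc prod.lessThan_Suc)
  qed simp
  have term_eq: "jacobi_term z Q (int k - int N) = jacobi_term z Q (- int N) * (Q ^ (k choose 2) * x ^ k)" for k
  proof (induction k)
    case (Suc k)
    have "jacobi_term z Q (int (Suc k) - int N) = - z * Q powi (int k - int N) * jacobi_term z Q (int k - int N)"
      using jacobi_term_plus1[of "int k - int N"] by (simp add: algebra_simps)
    also have "- z * Q powi (int k - int N) = x * Q ^ k"
      using Q by (simp add: x_def power_int_diff)
    finally show ?case
      by (simp add: Suc numeral_2_eq_2 power_add mult_ac)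
  qed (simp add: numeral_2_eq_2)
  have "(\<Prod>k<2*N. 1 + x * Q ^ k) = (\<Prod>k<N. 1 + x * Q ^ k) * (\<Prod>k<N. 1 + x * Q ^ (k + N))"
    using prod.nat_group[of "\<lambda>k. 1 + x * Q ^ k" N 2]
    by (simp add: numeral_2_eq_2 prod.shift_bounds_nat_ivl[of _ 0 N N, simplified] lessThan_atLeast0)
  also have "(\<Prod>k<N. 1 + x * Q ^ (k + N)) = (\<Prod>k<N. 1 - z * Q ^ k)"
    using Q by (simp add: x_def power_add)
  also have "(\<Prod>k<N. 1 + x * Q ^ k) = (\<Prod>j<N. 1 - z / Q ^ Suc j)"
  proof (subst prod.nat_diff_reindex [symmetric], rule prod.cong)
    fix j assume "j \<in> {..<N}"
    hence "Q ^ N = Q ^ (N - Suc j) * Q ^ Suc j" by (simp flip: power_add power_Suc)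
    thus "1 + x * Q ^ (N - Suc j) = 1 - z / Q ^ Suc j"
      using Q by (simp add: x_def)
  qed auto
  finally have "(\<Prod>k<N. 1 - z * Q ^ k) * (\<Prod>k<N. 1 - Q / z * Q ^ k) =
                jacobi_term z Q (- int N) * (\<Prod>k<2*N. 1 + x * Q ^ k)"
    by (simp only: low [symmetric]) (simp only: mult_ac)
  also have "\<dots> = (\<Sum>k\<le>2*N. jacobi_term z Q (int k - int N) * gauss_binomial Q (2 * N) k)"
    unfolding gauss_binomial_theorem sum_distrib_left by (simp add: term_eq mult_ac)
  finally show ?thesis .
qed

lemma summable_norm_ratio_tendsto_0:
  fixes f r :: "nat \<Rightarrow> complex"
  assumes "\<And>n. f (Suc n) = r n * f n" "r \<longlonglongrightarrow> 0"
  shows "summable (\<lambda>n. norm (f n))"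
proof -
  have "eventually (\<lambda>n. norm (r n) < 1 / 2) sequentially"
    using assms(2) by (intro order_tendstoD(2)[of _ 0] tendsto_norm_zero) auto
  then obtain N where "\<And>n. n \<ge> N \<Longrightarrow> norm (r n) < 1 / 2"
    by (auto simp: eventually_at_top_linorder)
  hence "norm (f (Suc n)) \<le> 1 / 2 * norm (f n)" if "n \<ge> N" for n
    using that unfolding assms(1) norm_mult by (intro mult_right_mono) (auto intro: less_imp_le)
  thus ?thesis
    by (intro summable_ratio_test[of "1 / 2" N]) auto
qed

text \<open>The ratio of consecutive terms tends to 0 in both directions, so each half of the series
  passes the ratio test.\<close>

lemma jacobi_term_abs_summable:
  assumes "norm Q < 1"
  shows "(\<lambda>n. norm (jacobi_term z Q n)) summable_on UNIV"
proof -
  have Q0: "(\<lambda>n. Q ^ n) \<longlonglongrightarrow> 0" using assms by (rule LIMSEQ_power_zero)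
  have "(\<lambda>n. - z * Q ^ n) \<longlonglongrightarrow> - z * 0" by (intro tendsto_intros Q0)
  hence "summable (\<lambda>n. norm (jacobi_term z Q (int n)))"
    using jacobi_term_plus1[of "int n" for n]
    by (intro summable_norm_ratio_tendsto_0[of _ "\<lambda>n. - z * Q ^ n"]) (auto simp: add.commute)
  hence 1: "(\<lambda>n. norm (jacobi_term z Q n)) summable_on range int"
    by (subst summable_on_reindex) (auto simp: o_def intro!: norm_summable_imp_summable_on)
  have "(\<lambda>n. - (Q ^ Suc n / z)) \<longlonglongrightarrow> - (0 / z)"
    using LIMSEQ_Suc[OF Q0] z by (intro tendsto_intros)
  hence "summable (\<lambda>n. norm (jacobi_term z Q (- int n)))"
    by (intro summable_norm_ratio_tendsto_0[of _ "\<lambda>n. - (Q ^ Suc n / z)"])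
       (auto simp only: jacobi_term_uminus_Suc mult.commute div_0 minus_zero)
  hence 2: "(\<lambda>n. norm (jacobi_term z Q n)) summable_on range (\<lambda>n. - int n)"
    by (subst summable_on_reindex) (auto simp: o_def inj_on_def intro!: norm_summable_imp_summable_on)
  have "n \<in> range int \<union> range (\<lambda>n. - int n)" for n :: int
    by (cases n rule: int_cases2) auto
  hence "range int \<union> range (\<lambda>n. - int n) = UNIV" by blast
  with summable_on_union[OF 1 2] show ?thesis by simp
qed

text \<open>The coefficient is P(2 N) / (P(N + n) P(N - n)), where P converges to a nonzero limit.
  Boundedness of P and of 1 / P yields a bound uniform in N and n, as dominated convergence
  requires.\<close>

lemma gauss_binomial_centred_limit:
  assumes "norm Q < 1"
  shows "(\<lambda>N. gauss_binomial_centred Q N n) \<longlonglongrightarrow> inverse (qpoch_inf Q Q)"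
    and "\<exists>K. \<forall>N n. norm (gauss_binomial_centred Q N n) \<le> K"
proof -
  define P where "P = (\<lambda>n. \<Prod>i<n. 1 - Q ^ Suc i)"
  define c where "c = gauss_binomial_centred Q"
  note c_def' = c_def gauss_binomial_centred_def
  have nz: "P n \<noteq> 0" for n
    unfolding P_def using one_minus_power_nonzero[OF assms(1), of "Suc i" for i] by simp
  have L: "qpoch_inf Q Q \<noteq> 0"
    using qpoch_inf_power_nonzero[OF assms(1), of 1 1] by simp
  have P: "P \<longlonglongrightarrow> qpoch_inf Q Q"
    using qpoch_inf_LIMSEQ[OF assms(1), of Q] by (simp add: P_def)
  hence P': "(\<lambda>n. inverse (P n)) \<longlonglongrightarrow> inverse (qpoch_inf Q Q)"
    using L by (intro tendsto_inverse)
  have c: "c N n = P (2 * N) * inverse (P (nat (n + int N))) * inverse (P (nat (int N - n)))"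
    if "\<bar>n\<bar> \<le> int N" for N n
  proof -
    have "nat (n + int N) + nat (int N - n) = 2 * N" using that by linarith
    with gauss_binomial_mult[of Q "nat (n + int N)" "nat (int N - n)"]
    have "c N n * (P (nat (n + int N)) * P (nat (int N - n))) = P (2 * N)"
      using that by (simp add: c_def' P_def)
    thus ?thesis
      using nz[of "nat (n + int N)"] nz[of "nat (int N - n)"] by (simp add: field_simps)
  qed
  have "(\<lambda>N. c N n) \<longlonglongrightarrow> inverse (qpoch_inf Q Q)"
  proof (rule Lim_transform_eventually)
    have "filterlim (\<lambda>N. 2 * N) at_top (sequentially :: nat filter)"
         "filterlim (\<lambda>N. nat (n + int N)) at_top sequentially"
         "filterlim (\<lambda>N. nat (int N - n)) at_top sequentially"
      by real_asymp+
    from filterlim_compose[OF P this(1)] filterlim_compose[OF P' this(2)] filterlim_compose[OF P' this(3)]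
    have "(\<lambda>N. P (2 * N) * inverse (P (nat (n + int N))) * inverse (P (nat (int N - n))))
            \<longlonglongrightarrow> qpoch_inf Q Q * inverse (qpoch_inf Q Q) * inverse (qpoch_inf Q Q)"
      by (intro tendsto_mult)
    thus "(\<lambda>N. P (2 * N) * inverse (P (nat (n + int N))) * inverse (P (nat (int N - n))))
            \<longlonglongrightarrow> inverse (qpoch_inf Q Q)"
      using L by simp
    show "eventually (\<lambda>N. P (2 * N) * inverse (P (nat (n + int N))) * inverse (P (nat (int N - n))) = c N n)
            sequentially"
      using eventually_ge_at_top[of "nat \<bar>n\<bar>"] by eventually_elim (simp add: c)
  qed
  thus "(\<lambda>N. gauss_binomial_centred Q N n) \<longlonglongrightarrow> inverse (qpoch_inf Q Q)"
    by (simp add: c_def)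
  obtain B where B: "\<And>n. norm (P n) \<le> B" "B > 0"
    using P convergentI convergent_imp_Bseq BseqE by metis
  obtain B' where B': "\<And>n. norm (inverse (P n)) \<le> B'" "B' > 0"
    using P' convergentI convergent_imp_Bseq BseqE by metis
  have "norm (c N n) \<le> B * B' * B'" for N n
  proof (cases "\<bar>n\<bar> \<le> int N")
    case True
    thus ?thesis
      unfolding c[OF True] norm_mult using B B' by (intro mult_mono) auto
  qed (use B B' in \<open>auto simp: c_def'\<close>)
  thus "\<exists>K. \<forall>N n. norm (gauss_binomial_centred Q N n) \<le> K" unfolding c_def by blast
qed

text \<open>In the finite identity N tends to infinity. The integers are enumerated by
  \<open>int_decode\<close>, so that Tannery's theorem applies with majorant K times the norm of the
  theta term; the limit 1 / (Q;Q) of the coefficients becomes the third factor.\<close>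

theorem jacobi_triple_product:
  assumes "norm Q < 1"
  shows "(jacobi_term z Q has_sum qpoch_inf z Q * qpoch_inf (Q / z) Q * qpoch_inf Q Q) UNIV"
proof -
  define c where "c = gauss_binomial_centred Q"
  note c_def' = c_def gauss_binomial_centred_def
  note lim = gauss_binomial_centred_limit[OF assms, folded c_def]
  define f where "f = (\<lambda>k. jacobi_term z Q (int_decode k))"
  define a where "a = (\<lambda>k N. f k * c N (int_decode k))"
  obtain K where K: "\<And>N n. norm (c N n) \<le> K" using lim(2) by auto
  have "(\<lambda>k. norm (f k)) summable_on UNIV"
    using jacobi_term_abs_summable[OF assms] unfolding f_def
    by (subst summable_on_reindex_bij_betw[OF bij_int_decode, of "\<lambda>n. norm (jacobi_term z Q n)"])
  hence sf: "summable (\<lambda>k. norm (f k))" by (rule summable_on_imp_summable)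
  have "summable (\<lambda>k. K * norm (f k))" by (intro summable_mult sf)
  moreover have "(\<lambda>N. a k N) \<longlonglongrightarrow> f k * inverse (qpoch_inf Q Q)" for k
    unfolding a_def by (intro tendsto_intros lim)
  moreover have "norm (a k N) \<le> K * norm (f k)" for k N
    unfolding a_def norm_mult using mult_left_mono[OF K[of N "int_decode k"], of "norm (f k)"]
    by (simp add: mult.commute)
  hence "eventually (\<lambda>(k, N). norm (a k N) \<le> K * norm (f k)) (at_top \<times>\<^sub>F sequentially)"
    by (intro always_eventually) auto
  ultimately have "(\<lambda>N. suminf (\<lambda>k. a k N)) \<longlonglongrightarrow> (\<Sum>k. f k * inverse (qpoch_inf Q Q))"
    using tannerys_theorem[of a "\<lambda>k. f k * inverse (qpoch_inf Q Q)" sequentially "\<lambda>k. K * norm (f k)"]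
    by auto
  moreover have "suminf (\<lambda>k. a k N) = (\<Prod>k<N. 1 - z * Q ^ k) * (\<Prod>k<N. 1 - Q / z * Q ^ k)" for N
  proof -
    have "suminf (\<lambda>k. a k N) = (\<Sum>k\<in>int_encode ` {-int N..int N}. a k N)"
    proof (rule suminf_finite)
      fix k assume "k \<notin> int_encode ` {-int N..int N}"
      hence "int_decode k \<notin> {-int N..int N}" by (metis imageI int_decode_inverse)
      hence "\<not> \<bar>int_decode k\<bar> \<le> int N" by auto
      thus "a k N = 0" by (simp only: a_def c_def' if_False mult_zero_right)
    qed auto
    also have "\<dots> = (\<Sum>n=-int N..int N. jacobi_term z Q n * c N n)"
      by (subst sum.reindex) (auto simp: a_def f_def inj_int_encode)
    also have "\<dots> = (\<Sum>k\<le>2*N. jacobi_term z Q (int k - int N) * gauss_binomial Q (2 * N) k)"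
      by (rule sum.reindex_bij_witness[of _ "\<lambda>k. int k - int N" "\<lambda>n. nat (n + int N)"])
         (auto simp: c_def')
    finally show ?thesis by (simp only: jacobi_triple_product_finite)
  qed
  moreover have "(\<lambda>N. (\<Prod>k<N. 1 - z * Q ^ k) * (\<Prod>k<N. 1 - Q / z * Q ^ k))
                   \<longlonglongrightarrow> qpoch_inf z Q * qpoch_inf (Q / z) Q"
    by (intro tendsto_mult qpoch_inf_LIMSEQ assms)
  ultimately have "(\<Sum>k. f k * inverse (qpoch_inf Q Q)) = qpoch_inf z Q * qpoch_inf (Q / z) Q"
    by (auto intro: LIMSEQ_unique)
  moreover have "qpoch_inf Q Q \<noteq> 0"
    using qpoch_inf_power_nonzero[OF assms, of 1 1] by simp
  moreover have "(\<Sum>k. f k * inverse (qpoch_inf Q Q)) = (\<Sum>k. f k) * inverse (qpoch_inf Q Q)"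
    by (rule suminf_mult2[symmetric, OF summable_norm_cancel[OF sf]])
  ultimately have "(\<Sum>k. f k) = qpoch_inf z Q * qpoch_inf (Q / z) Q * qpoch_inf Q Q"
    by (simp add: field_simps)
  moreover have "f sums (\<Sum>k. f k)"
    by (rule summable_sums[OF summable_norm_cancel[OF sf]])
  ultimately have "(f has_sum qpoch_inf z Q * qpoch_inf (Q / z) Q * qpoch_inf Q Q) UNIV"
    using norm_summable_imp_has_sum[OF sf] by simp
  thus ?thesis
    using has_sum_reindex_bij_betw[OF bij_int_decode, of "jacobi_term z Q"] by (simp add: f_def)
qed

end

section \<open>A quintic theta function identity\<close>

definition qprod5 :: "nat \<Rightarrow> complex \<Rightarrow> complex" where
  "qprod5 m q = qpoch_inf (q ^ m) (q ^ 5)"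

lemma norm_power_less_1: "norm (q :: complex) < 1 \<Longrightarrow> n > 0 \<Longrightarrow> norm (q ^ n) < 1"
  by (simp add: norm_power power_less_one_iff)

lemma qprod5_nonzero: "norm q < 1 \<Longrightarrow> m > 0 \<Longrightarrow> qprod5 m q \<noteq> 0"
  unfolding qprod5_def by (intro qpoch_inf_power_nonzero) auto

text \<open>The factors of (x;x) with x = q^5 are sorted by the residue of their exponent modulo 5.
  This expresses the extra factor of the theta functions at q through products at q^5.\<close>

lemma qprod5_5_split:
  assumes "norm q < 1"
  shows "qprod5 5 q = qprod5 1 (q^5) * qprod5 2 (q^5) * qprod5 3 (q^5) * qprod5 4 (q^5) * qprod5 5 (q^5)"
proof -
  define x where "x = q ^ 5"
  have x: "norm x < 1" "norm (x ^ 5) < 1"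
    using assms by (auto simp: x_def norm_power_less_1)
  define f where "f = (\<lambda>k. 1 - x * x ^ k)"
  have "(\<lambda>N. \<Prod>k<N. f k) \<longlonglongrightarrow> qpoch_inf x x"
    unfolding f_def by (rule qpoch_inf_LIMSEQ[OF x(1)])
  hence "(\<lambda>N. \<Prod>k<N*5. f k) \<longlonglongrightarrow> qpoch_inf x x"
    by (rule filterlim_compose) real_asymp
  moreover have "(\<Prod>k<N*5. f k) =
      (\<Prod>k<N. 1 - x ^ 1 * (x ^ 5) ^ k) * (\<Prod>k<N. 1 - x ^ 2 * (x ^ 5) ^ k) *
      (\<Prod>k<N. 1 - x ^ 3 * (x ^ 5) ^ k) * (\<Prod>k<N. 1 - x ^ 4 * (x ^ 5) ^ k) *
      (\<Prod>k<N. 1 - x ^ 5 * (x ^ 5) ^ k)" for N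
  proof (induction N)
    case (Suc N)
    have "(\<Prod>k<Suc N*5. f k) = (\<Prod>k<N*5. f k) * 
       (f (N*5) * f (N*5+1) * f (N*5+2) * f (N*5+3) * f (N*5+4))"
      by (simp add: eval_nat_numeral mult_ac)
    also have "f (N*5) * f (N*5+1) * f (N*5+2) * f (N*5+3) * f (N*5+4) = 
       (1 - x ^ 1 * (x ^ 5) ^ N) * (1 - x ^ 2 * (x ^ 5) ^ N) * (1 - x ^ 3 * (x ^ 5) ^ N) *
       (1 - x ^ 4 * (x ^ 5) ^ N) * (1 - x ^ 5 * (x ^ 5) ^ N)"
      by (simp add: f_def power_add flip: power_mult power_Suc) (simp add: eval_nat_numeral mult_ac)
    finally show ?case unfolding Suc by (simp add: mult_ac)
  qed simp
  moreover have "(\<lambda>N. (\<Prod>k<N. 1 - x ^ 1 * (x ^ 5) ^ k) * (\<Prod>k<N. 1 - x ^ 2 * (x ^ 5) ^ k) *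
      (\<Prod>k<N. 1 - x ^ 3 * (x ^ 5) ^ k) * (\<Prod>k<N. 1 - x ^ 4 * (x ^ 5) ^ k) *
      (\<Prod>k<N. 1 - x ^ 5 * (x ^ 5) ^ k)) \<longlonglongrightarrow> 
      qprod5 1 x * qprod5 2 x * qprod5 3 x * qprod5 4 x * qprod5 5 x"
    unfolding qprod5_def by (intro tendsto_mult qpoch_inf_LIMSEQ x)
  ultimately have "qpoch_inf x x = qprod5 1 x * qprod5 2 x * qprod5 3 x * qprod5 4 x * qprod5 5 x"
    by (simp add: LIMSEQ_unique)
  thus ?thesis by (simp add: qprod5_def x_def)
qed

lemma has_sum_product:
  fixes f :: "'a \<Rightarrow> complex" and g :: "'b \<Rightarrow> complex"
  assumes "(\<lambda>x. norm (f x)) summable_on A" "(\<lambda>y. norm (g y)) summable_on B"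
    and "(f has_sum F) A" "(g has_sum G) B"
  shows "((\<lambda>(x, y). f x * g y) has_sum F * G) (A \<times> B)"
proof (rule has_sum_SigmaI)
  show "((\<lambda>y. case (x, y) of (x, y) \<Rightarrow> f x * g y) has_sum f x * G) B" for x
    using has_sum_cmult_right[OF assms(4)] by simp
  show "((\<lambda>x. f x * G) has_sum F * G) A"
    by (rule has_sum_cmult_left[OF assms(3)])
  have "(\<lambda>z. norm (case z of (x, y) \<Rightarrow> f x * g y)) summable_on A \<times> B"
  proof (rule summable_on_SigmaI)
    show "((\<lambda>y. norm (case (x, y) of (x, y) \<Rightarrow> f x * g y)) has_sum norm (f x) * (\<Sum>\<^sub>\<infinity>y\<in>B. norm (g y))) B" for x
      using has_sum_cmult_right[OF has_sum_infsum[OF assms(2)], of "norm (f x)"] by (simp add: norm_mult)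
    show "(\<lambda>x. norm (f x) * (\<Sum>\<^sub>\<infinity>y\<in>B. norm (g y))) summable_on A"
      by (rule summable_on_cmult_left[OF assms(1)])
  qed auto
  thus "(\<lambda>(x, y). f x * g y) summable_on A \<times> B"
    by (rule abs_summable_summable)
qed

lemma jacobi_term_power:
  assumes "q \<noteq> 0"
  shows "jacobi_term (q ^ j) (q ^ d) n = (-1) powi n * q powi (int j * n + int d * triangle n)"
proof -
  have "(- (q ^ j)) powi n = (-1) powi n * (q ^ j) powi n"
    by (subst power_int_mult_distrib [symmetric]) simp
  thus ?thesis using assms
    by (simp add: jacobi_term_def power_int_add power_int_mult mult.assoc flip: power_int_of_nat)
qed

lemma minus_one_powi: "(-1 :: complex) powi n = (if even n then 1 else -1)"
  by (cases "even n") simp_all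

lemma qprod5_theta:
  assumes "q \<noteq> 0" "norm q < 1" "0 < j" "j < 5"
  shows "(jacobi_term (q ^ j) (q ^ 5) has_sum qprod5 j q * qprod5 (5 - j) q * qprod5 5 q) UNIV"
proof -
  have "q ^ 5 / q ^ j = q ^ (5 - j)"
    using assms by (subst power_diff) auto
  thus ?thesis
    using jacobi_triple_product[of "q ^ j" "q ^ 5"] assms
    by (simp add: qprod5_def norm_power_less_1)
qed

lemma triangle_reflect: "triangle (1 - a) = triangle a"
  using two_triangle[of a] two_triangle[of "1 - a"] by (simp add: algebra_simps)

text \<open>The map (m, n) \<mapsto> (2 m - n, m + 2 n) multiplies the form m^2 + n^2 by 5; it
  identifies the double series of the product of the two theta functions with a sum over a
  sublattice of index 5, whose five cosets modulo 5 give products of theta functions in q^5.\<close>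

lemma jacobi_term_quintic:
  assumes "q \<noteq> 0"
  shows "jacobi_term q (q ^ 5) m * jacobi_term (q ^ 2) (q ^ 5) n =
         jacobi_term 1 q (2 * m - n) * jacobi_term 1 q (m + 2 * n)"
proof -
  have "2 * (m + 5 * triangle m + (2 * n + 5 * triangle n)) =
        2 * (triangle (2 * m - n) + triangle (m + 2 * n))"
    using two_triangle[of m] two_triangle[of n] two_triangle[of "2 * m - n"] two_triangle[of "m + 2 * n"]
    by (simp add: algebra_simps)
  hence e: "m + 5 * triangle m + (2 * n + 5 * triangle n) = triangle (2 * m - n) + triangle (m + 2 * n)"
    by simp
  have "(-1) powi (2 * m - n) * (-1) powi (m + 2 * n) = ((-1) powi m * (-1) powi n :: complex)"
    by (cases "even m"; cases "even n") simp_all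
  thus ?thesis
    using jacobi_term_power[OF assms, of 1 5 m] jacobi_term_power[OF assms, of 2 5 n]
          arg_cong[OF e, of "\<lambda>e. q powi e"] assms
    by (simp add: jacobi_term_def power_int_add mult_ac)
qed

text \<open>On the sublattice the class r of a modulo 5 forces the class 3 r of b, so the product is
  the sum of S r * S (3 r mod 5). The symmetry a -> 1 - a reduces the five class sums to S 0 and S
  2, leaving a quadratic form in these two.\<close>

lemma theta_product_quintic:
  assumes q: "q \<noteq> 0" "norm q < 1"
  defines "\<theta>\<^sub>1 \<equiv> \<lambda>q. qprod5 1 q * qprod5 4 q * qprod5 5 q"
  defines "\<theta>\<^sub>2 \<equiv> \<lambda>q. qprod5 2 q * qprod5 3 q * qprod5 5 q"
  shows "\<theta>\<^sub>1 q * \<theta>\<^sub>2 q = \<theta>\<^sub>2 (q^5) ^ 2 - q * \<theta>\<^sub>1 (q^5) * \<theta>\<^sub>2 (q^5) - q ^ 2 * \<theta>\<^sub>1 (q^5) ^ 2"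
proof -
  define s where "s = jacobi_term 1 q"
  define S where "S = (\<lambda>r. \<Sum>\<^sub>\<infinity>k. s (5 * k + r))"
  have \<theta>1: "(jacobi_term x (x ^ 5) has_sum \<theta>\<^sub>1 x) UNIV"
   and \<theta>2: "(jacobi_term (x ^ 2) (x ^ 5) has_sum \<theta>\<^sub>2 x) UNIV" if "x \<noteq> 0" "norm x < 1" for x
    using qprod5_theta[OF that, of 1] qprod5_theta[OF that, of 2] by (simp_all add: \<theta>\<^sub>1_def \<theta>\<^sub>2_def)
  have s_abs: "(\<lambda>a. norm (s a)) summable_on UNIV"
    unfolding s_def using q by (intro jacobi_term_abs_summable) auto
  have s_abs': "(\<lambda>k. norm (s (5 * k + r))) summable_on UNIV" for r
  proof -
    have "(\<lambda>a. norm (s a)) summable_on range (\<lambda>k. 5 * k + r)"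
      by (rule summable_on_subset_banach[OF s_abs]) auto
    thus ?thesis
      by (subst (asm) summable_on_reindex) (auto simp: o_def inj_on_def)
  qed
  have S: "((\<lambda>k. s (5 * k + r)) has_sum S r) UNIV" for r
    unfolding S_def by (rule has_sum_infsum[OF abs_summable_summable[OF s_abs']])
  have s_reflect: "s (1 - a) = - s a" for a
    by (simp add: s_def jacobi_term_def triangle_reflect minus_one_powi)
  have S_reflect: "S (1 - r) = - S r" for r
  proof -
    have "S (1 - r) = (\<Sum>\<^sub>\<infinity>k. - s (5 * k + r))"
      unfolding S_def
      by (rule infsum_reindex_bij_witness[of _ uminus uminus]) (auto simp: algebra_simps simp flip: s_reflect)
    thus ?thesis by (simp add: S_def infsum_uminus)
  qed
  have S_shift: "S (r + 5) = S r" for r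
    unfolding S_def
    by (rule infsum_reindex_bij_witness[of _ "\<lambda>k. k - 1" "\<lambda>k. k + 1"]) (auto simp: algebra_simps)
  \<comment> \<open>The map a -> 1 - a changes the sign of s and acts on the classes modulo 5 by
    fixing 3 and exchanging 0 with 1 and 2 with 4.\<close>
  have S3: "S 3 = 0" and S1: "S 1 = - S 0" and S4: "S 4 = - S 2"
    using S_reflect[of "-2"] S_shift[of "-2"] S_reflect[of 0] S_reflect[of "-3"] S_shift[of "-3"]
    by auto
  have S0: "S 0 = \<theta>\<^sub>2 (q ^ 5)"
  proof -
    have "s (5 * k + 0) = jacobi_term ((q ^ 5) ^ 2) ((q ^ 5) ^ 5) k" for k
    proof -
      have "triangle (5 * k) = 10 * k + 25 * triangle k"
        using two_triangle[of k] two_triangle[of "5 * k"] by (simp add: algebra_simps)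
      thus ?thesis
        using jacobi_term_power[OF q(1), of 10 25 k]
        by (simp add: s_def jacobi_term_def minus_one_powi flip: power_mult)
    qed
    thus ?thesis
      using S[of 0] \<theta>2[of "q ^ 5"] q by (auto simp: norm_power_less_1 intro: has_sum_unique)
  qed
  have S2: "S 2 = q * \<theta>\<^sub>1 (q ^ 5)"
  proof -
    \<comment> \<open>Replacing k by -k brings the exponent to 1 + 5 k + 25
      \<open>triangle k\<close>, with parameter q^5; in the form 5 k + 2 the parameter would be
      q^20.\<close>
    have "s (5 * (- k) + 2) = q * jacobi_term (q ^ 5) ((q ^ 5) ^ 5) k" for k
    proof -
      have "triangle (5 * (- k) + 2) = 1 + (5 * k + 25 * triangle k)"
        using two_triangle[of k] two_triangle[of "5 * (- k) + 2"] by (simp add: algebra_simps)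
      moreover have "(-1) powi (5 * (- k) + 2) = ((-1) powi k :: complex)"
        by (simp add: minus_one_powi)
      ultimately show ?thesis
        using jacobi_term_power[OF q(1), of 5 25 k] q(1)
        by (simp add: s_def jacobi_term_def power_int_add flip: power_mult)
    qed
    moreover have "((\<lambda>k. s (5 * (- k) + 2)) has_sum S 2) UNIV"
      using S[of 2] by (subst has_sum_reindex_bij_witness[of _ uminus uminus]) auto
    ultimately show ?thesis
      using has_sum_cmult_right[OF \<theta>1[of "q ^ 5"], of q] q
      by (auto simp: norm_power_less_1 intro: has_sum_unique)
  qed
  define L where "L = {(a, b :: int). b mod 5 = 3 * a mod 5}"
  \<comment> \<open>The inverse of j: both divisions by 5 are exact precisely on L.\<close>
  define i where "i = (\<lambda>(a, b). ((2 * a + b) div 5, (2 * b - a) div 5 :: int))"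
  define j where "j = (\<lambda>(m, n). (2 * m - n, m + 2 * n :: int))"
  \<comment> \<open>The pairs in L are split by the residue r of the first entry, which determines
    the residue of the second.\<close>
  define i' where "i' = (\<lambda>(r, (k, l)). (5 * k + r, 5 * l + 3 * r mod 5 :: int))"
  define j' where "j' = (\<lambda>(a, b). (a mod 5 :: int, (a div 5, b div 5 :: int)))"
  have "((\<lambda>(m, n). jacobi_term q (q ^ 5) m * jacobi_term (q ^ 2) (q ^ 5) n) has_sum \<theta>\<^sub>1 q * \<theta>\<^sub>2 q)
          (UNIV \<times> UNIV)"
    using q by (intro has_sum_product jacobi_term_abs_summable \<theta>1 \<theta>2) (auto simp: norm_power_less_1)
  also have "?this \<longleftrightarrow> ((\<lambda>(a, b). s a * s b) has_sum \<theta>\<^sub>1 q * \<theta>\<^sub>2 q) L"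
  proof (rule has_sum_reindex_bij_witness[of _ i j])
    show "i (j x) = x" for x by (auto simp: i_def j_def split: prod.splits)
    show "j x \<in> L" for x
    proof -
      have "m + 2 * n - 3 * (2 * m - n) = 5 * (n - m)" for m n :: int by simp
      hence "5 dvd (m + 2 * n - 3 * (2 * m - n))" for m n :: int by (metis dvd_triv_left)
      thus ?thesis by (auto simp: j_def L_def mod_eq_dvd_iff split: prod.splits)
    qed
    show "j (i y) = y" if y: "y \<in> L" for y
    proof -
      obtain a b where ab: "y = (a, b)" by force
      hence "5 dvd (b - 3 * a)" using y by (simp add: L_def mod_eq_dvd_iff)
      then obtain t where "b - 3 * a = 5 * t" by (elim dvdE)
      hence "2 * a + b = 5 * (a + t)" "2 * b - a = 5 * (a + 2 * t)" by auto
      hence "i y = (a + t, a + 2 * t)" by (simp add: i_def ab)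
      thus ?thesis using \<open>b - 3 * a = 5 * t\<close> by (simp add: j_def ab)
    qed
    show "(case j x of (a, b) \<Rightarrow> s a * s b) =
          (case x of (m, n) \<Rightarrow> jacobi_term q (q ^ 5) m * jacobi_term (q ^ 2) (q ^ 5) n)" for x
      by (auto simp: j_def s_def jacobi_term_quintic[OF q(1)] split: prod.splits)
  qed auto
  also have "\<dots> \<longleftrightarrow> ((\<lambda>(r, (k, l)). s (5 * k + r) * s (5 * l + 3 * r mod 5)) has_sum \<theta>\<^sub>1 q * \<theta>\<^sub>2 q)
                      ({0..<5} \<times> UNIV \<times> UNIV)"
  proof (rule has_sum_reindex_bij_witness[of _ i' j'])
    show "i' (j' y) = y" if "y \<in> L" for y
      using that by (auto simp: i'_def j'_def L_def mod_mult_right_eq) (metis mult_div_mod_eq)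
    show "j' y \<in> {0..<5} \<times> UNIV \<times> UNIV" for y by (auto simp: j'_def split: prod.splits)
    show "j' (i' x) = x" if "x \<in> {0..<5} \<times> UNIV \<times> UNIV" for x
      using that by (auto simp: i'_def j'_def)
    have "(15 * k + 3 * r) mod 5 = 3 * r mod 5" for k r :: int
      using mod_mult_self4[of 5 "3 * k" "3 * r"] by simp
    thus "i' x \<in> L" if "x \<in> {0..<5} \<times> UNIV \<times> UNIV" for x
      using that unfolding i'_def L_def by (auto split: prod.splits simp: mod_simps)
    show "(case j' y of (r, k, l) \<Rightarrow> s (5 * k + r) * s (5 * l + 3 * r mod 5)) =
          (case y of (a, b) \<Rightarrow> s a * s b)" if "y \<in> L" for y
      using that by (auto simp: j'_def L_def mod_mult_right_eq) (metis mult_div_mod_eq)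
  qed auto
  finally have sum: "((\<lambda>(r, (k, l)). s (5 * k + r) * s (5 * l + 3 * r mod 5)) has_sum \<theta>\<^sub>1 q * \<theta>\<^sub>2 q)
                       ({0..<5} \<times> UNIV \<times> UNIV)" .
  have "((\<lambda>(r, (k, l)). s (5 * k + r) * s (5 * l + 3 * r mod 5)) has_sum
           (\<Sum>r\<in>{0..<5}. S r * S (3 * r mod 5))) ({0..<5} \<times> UNIV \<times> UNIV)"
  proof (rule has_sum_SigmaI)
    show "((\<lambda>x. case (r, x) of (r, k, l) \<Rightarrow> s (5 * k + r) * s (5 * l + 3 * r mod 5)) has_sum
             S r * S (3 * r mod 5)) (UNIV \<times> UNIV)" for r
      using has_sum_product[OF s_abs' s_abs' S S] by simp
  qed (use sum in \<open>auto simp: summable_on_def\<close>)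
  with sum have "\<theta>\<^sub>1 q * \<theta>\<^sub>2 q = (\<Sum>r\<in>{0..<5}. S r * S (3 * r mod 5))"
    by (rule has_sum_unique)
  also have "{0..<5} = {0, 1, 2, 3, 4 :: int}" by auto
  finally show ?thesis
    by (simp add: S3 S1 S4) (simp add: S0 S2 power2_eq_square algebra_simps)
qed

section \<open>The modular equations\<close>

definition rr_G :: "complex \<Rightarrow> complex" where
  "rr_G q = inverse (qprod5 1 q * qprod5 4 q)"

definition rr_H :: "complex \<Rightarrow> complex" where
  "rr_H q = inverse (qprod5 2 q * qprod5 3 q)"

lemma rr_R_conv_GH: "rr_R q = rr_H q / rr_G q"
  by (simp add: rr_R_def rr_G_def rr_H_def qprod5_def field_simps)

lemma qprod5_0: "m > 0 \<Longrightarrow> qprod5 m 0 = 1"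
  by (simp add: qprod5_def qpoch_inf_def power_0_left)

lemma rr_GH_0: "rr_G 0 = 1" "rr_H 0 = 1"
  by (simp_all add: rr_G_def rr_H_def qprod5_0)

lemma rr_GH_quintic:
  assumes q: "norm q < 1"
  defines "x \<equiv> q ^ 5"
  shows "rr_G q * rr_H q * (rr_G x ^ 2 - q * rr_G x * rr_H x - q ^ 2 * rr_H x ^ 2) = 1"
proof (cases "q = 0")
  case True
  thus ?thesis by (simp add: x_def rr_GH_0)
next
  case False
  have x: "norm x < 1" using q by (simp add: x_def norm_power_less_1)
  define a where "a = qprod5 1 q * qprod5 4 q"
  define b where "b = qprod5 2 q * qprod5 3 q"
  define A where "A = qprod5 1 x * qprod5 4 x"
  define B where "B = qprod5 2 x * qprod5 3 x"
  define e where "e = qprod5 5 x"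
  have nz: "a \<noteq> 0" "b \<noteq> 0" "A \<noteq> 0" "B \<noteq> 0" "e \<noteq> 0"
    using q x by (auto simp: a_def b_def A_def B_def e_def qprod5_nonzero)
  \<comment> \<open>After this regrouping both sides of the theta identity carry e^2, and its
    cancellation leaves a relation between a, b, A and B only.\<close>
  have "qprod5 5 q = A * B * e"
    using qprod5_5_split[OF q] by (simp add: A_def B_def e_def x_def mult_ac)
  hence "(a * (A * B * e)) * (b * (A * B * e)) =
         (B * e) ^ 2 - q * (A * e) * (B * e) - q ^ 2 * (A * e) ^ 2"
    using theta_product_quintic[OF False q]
    by (simp only: a_def b_def A_def B_def e_def x_def)
  hence "e ^ 2 * (a * b * (A * B) ^ 2) = e ^ 2 * (B ^ 2 - q * A * B - q ^ 2 * A ^ 2)"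
    by (simp add: power2_eq_square algebra_simps)
  hence *: "a * b * (A * B) ^ 2 = B ^ 2 - q * A * B - q ^ 2 * A ^ 2"
    using nz by simp
  have "inverse A ^ 2 - q * inverse A * inverse B - q ^ 2 * inverse B ^ 2 =
        (B ^ 2 - q * A * B - q ^ 2 * A ^ 2) / (A * B) ^ 2"
    using nz by (simp add: field_simps power2_eq_square)
  also have "\<dots> = a * b" unfolding * [symmetric] using nz by simp
  finally have "inverse A ^ 2 - q * inverse A * inverse B - q ^ 2 * inverse B ^ 2 = a * b" .
  moreover have "rr_G q = inverse a" "rr_H q = inverse b" "rr_G x = inverse A" "rr_H x = inverse B"
    by (simp_all add: rr_G_def rr_H_def a_def b_def A_def B_def)
  ultimately have "rr_G q * rr_H q * (rr_G x ^ 2 - q * rr_G x * rr_H x - q ^ 2 * rr_H x ^ 2) =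
                   inverse a * inverse b * (a * b)"
    by (simp only:)
  also have "\<dots> = 1" using nz by (simp add: field_simps)
  finally show ?thesis .
qed

lemma prod_fifth_roots_unity:
  fixes a c w :: complex
  assumes "1 + w + w ^ 2 + w ^ 3 + w ^ 4 = 0"
  shows "(\<Prod>k<5. a - w ^ k * c) = a ^ 5 - c ^ 5"
proof -
  have "(a - c) * (a - w * c) * (a - w ^ 2 * c) * (a - w ^ 3 * c) * (a - w ^ 4 * c) = a ^ 5 - c ^ 5"
    using assms by algebra
  thus ?thesis by (simp add: eval_nat_numeral)
qed

lemma primitive_fifth_root_unity:
  obtains w :: complex where "\<And>j. j \<in> {1, 2, 3, 4} \<Longrightarrow> 1 + w ^ j + (w ^ j) ^ 2 + (w ^ j) ^ 3 + (w ^ j) ^ 4 = 0"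
    and "w ^ 5 = 1"
proof
  define w where "w = cis (2 * pi / 5)"
  show w5: "w ^ 5 = 1" unfolding w_def Complex.DeMoivre by simp
  have "cos (2 * pi / 5) < cos 0"
    by (intro cos_monotone_0_pi) auto
  hence w1: "w \<noteq> 1" by (auto simp: w_def complex_eq_iff)
  fix j :: nat assume j: "j \<in> {1, 2, 3, 4}"
  have "w ^ j \<noteq> 1"
  proof
    assume *: "w ^ j = 1"
    have "w ^ 6 = w ^ 5 * w" "w ^ 6 = (w ^ 2) ^ 3" "w ^ 6 = (w ^ 3) ^ 2" "w ^ 5 = w ^ 4 * w"
      by (simp_all add: eval_nat_numeral)
    hence e: "w = (w ^ 2) ^ 3" "w = (w ^ 3) ^ 2" "w ^ 4 * w = 1" by (simp_all only: w5 mult_1)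
    from j consider "j = 1" | "j = 2" | "j = 3" | "j = 4" by auto
    thus False
    proof cases
      case 2
      thus False using * e(1) w1 by (metis power_one)
    next
      case 3
      thus False using * e(2) w1 by (metis power_one)
    next
      case 4
      thus False using * e(3) w1 by simp
    qed (use * w1 in simp)
  qed
  moreover have "(w ^ j) ^ 5 = 1" using w5 by (metis power_commutes power_mult power_one mult.commute)
  hence "(w ^ j - 1) * (1 + w ^ j + (w ^ j) ^ 2 + (w ^ j) ^ 3 + (w ^ j) ^ 4) = 0"
    by (simp add: algebra_simps eval_nat_numeral)
  ultimately show "1 + w ^ j + (w ^ j) ^ 2 + (w ^ j) ^ 3 + (w ^ j) ^ 4 = 0" by simp
qed

text \<open>Each factor splits over the roots \<alpha>, \<beta> of X^2 = X + 1, so the product is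
  (a^5 - \<alpha>^5 c^5) (a^5 - \<beta>^5 c^5). The constant 11 is the Lucas number \<alpha>^5 +
  \<beta>^5, and (\<alpha> \<beta>)^5 = -1.\<close>

lemma prod_golden_fifth_roots_unity:
  fixes a c w :: complex
  assumes "1 + w + w ^ 2 + w ^ 3 + w ^ 4 = 0"
  shows "(\<Prod>k<5. a ^ 2 - w ^ k * c * a - (w ^ k * c) ^ 2) = a ^ 10 - 11 * c ^ 5 * a ^ 5 - c ^ 10"
proof -
  define \<alpha> where "\<alpha> = complex_of_real ((1 + sqrt 5) / 2)"
  define \<beta> where "\<beta> = complex_of_real ((1 - sqrt 5) / 2)"
  have "(1 + sqrt 5) / 2 + (1 - sqrt 5) / 2 = 1" "(1 + sqrt 5) / 2 * ((1 - sqrt 5) / 2) = -1"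
    by (simp_all add: field_simps)
  hence sum: "\<alpha> + \<beta> = 1" and prod: "\<alpha> * \<beta> = -1"
    unfolding \<alpha>_def \<beta>_def by (metis of_real_add of_real_1, metis of_real_mult of_real_1 of_real_minus)
  have "a ^ 2 - w ^ k * c * a - (w ^ k * c) ^ 2 = (a - w ^ k * (\<alpha> * c)) * (a - w ^ k * (\<beta> * c))" for k
  proof -
    have "(a - w ^ k * (\<alpha> * c)) * (a - w ^ k * (\<beta> * c)) =
          a ^ 2 - (\<alpha> + \<beta>) * (w ^ k * c * a) + \<alpha> * \<beta> * (w ^ k * c) ^ 2"
      by (simp add: algebra_simps power2_eq_square)
    thus ?thesis by (simp add: sum prod)
  qed
  hence "(\<Prod>k<5. a ^ 2 - w ^ k * c * a - (w ^ k * c) ^ 2) = (a ^ 5 - (\<alpha> * c) ^ 5) * (a ^ 5 - (\<beta> * c) ^ 5)"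
    by (simp only: prod.distrib prod_fifth_roots_unity[OF assms])
  also have "\<dots> = a ^ 10 - 11 * c ^ 5 * a ^ 5 - c ^ 10"
    using sum prod by algebra
  finally show ?thesis .
qed

text \<open>All conjugates have the same fifth power, hence the same base of the infinite product,
  and the five factors of index m multiply to 1 - y^(5 j) y^(25 m). The relation is required of w^j
  because j multiplies the exponent of the root of unity.\<close>

lemma prod_qprod5_fifth_roots_unity:
  assumes y: "norm y < 1" and w: "w ^ 5 = 1" "1 + w ^ j + (w ^ j) ^ 2 + (w ^ j) ^ 3 + (w ^ j) ^ 4 = 0"
  shows "(\<Prod>k<5. qprod5 j (w ^ k * y)) = qprod5 j (y ^ 5)"
proof (rule LIMSEQ_unique)
  have pow5: "(w ^ k * y) ^ 5 = y ^ 5" for k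
    using w(1) by (metis mult_1 power_mult power_mult_distrib power_one mult.commute)
  have y5: "norm (y ^ 5) < 1" using y by (simp add: norm_power_less_1)
  have "(\<lambda>N. \<Prod>k<5. \<Prod>m<N. 1 - (w ^ k * y) ^ j * (y ^ 5) ^ m) \<longlonglongrightarrow> (\<Prod>k<5. qprod5 j (w ^ k * y))"
    unfolding qprod5_def pow5 by (intro tendsto_prod qpoch_inf_LIMSEQ y5)
  also have "(\<lambda>N. \<Prod>k<5. \<Prod>m<N. 1 - (w ^ k * y) ^ j * (y ^ 5) ^ m) =
             (\<lambda>N. \<Prod>m<N. \<Prod>k<5. 1 - (w ^ j) ^ k * (y ^ j * (y ^ 5) ^ m))"
    by (subst prod.swap) (simp add: power_mult_distrib mult_ac flip: power_mult)
  also have "\<dots> = (\<lambda>N. \<Prod>m<N. 1 - (y ^ 5) ^ j * ((y ^ 5) ^ 5) ^ m)"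
    unfolding prod_fifth_roots_unity[OF w(2)]
    by (simp add: power_mult_distrib mult_ac flip: power_mult)
  finally show "(\<lambda>N. \<Prod>m<N. 1 - (y ^ 5) ^ j * ((y ^ 5) ^ 5) ^ m) \<longlonglongrightarrow> (\<Prod>k<5. qprod5 j (w ^ k * y))" .
  show "(\<lambda>N. \<Prod>m<N. 1 - (y ^ 5) ^ j * ((y ^ 5) ^ 5) ^ m) \<longlonglongrightarrow> qprod5 j (y ^ 5)"
    unfolding qprod5_def using y by (intro qpoch_inf_LIMSEQ norm_power_less_1) auto
qed

lemma rr_GH_eq_1:
  assumes x: "norm x < 1"
  defines "g \<equiv> rr_G x" and "h \<equiv> rr_H x"
  shows "g ^ 11 * h - 11 * x * g ^ 6 * h ^ 6 - x ^ 2 * g * h ^ 11 = 1"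
proof -
  obtain w :: complex where w: "\<And>j. j \<in> {1, 2, 3, 4} \<Longrightarrow> 1 + w ^ j + (w ^ j) ^ 2 + (w ^ j) ^ 3 + (w ^ j) ^ 4 = 0"
    and w5: "w ^ 5 = 1" by (rule primitive_fifth_root_unity) blast
  obtain y where y: "y ^ 5 = x"
    using exists_complex_root[of 5 x] by auto
  have nw: "norm w = 1" using power_eq_1_iff[OF w5] by simp
  have ny: "norm y < 1"
  proof -
    have "norm y ^ 5 < 1" using x by (simp only: y norm_power [symmetric])
    thus ?thesis by (simp add: power_less_one_iff)
  qed
  have nwy: "norm (w ^ k * y) < 1" for k
    using ny by (simp add: norm_mult norm_power nw)
  have pow5: "(w ^ k * y) ^ 5 = x" for k
  proof -
    have "(w ^ k * y) ^ 5 = (w ^ 5) ^ k * y ^ 5"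
      by (simp add: power_mult_distrib mult.commute flip: power_mult)
    thus ?thesis by (simp add: w5 y)
  qed
  have "(\<Prod>k<5. rr_G (w ^ k * y) * rr_H (w ^ k * y)) =
        inverse ((\<Prod>k<5. qprod5 1 (w ^ k * y)) * (\<Prod>k<5. qprod5 4 (w ^ k * y))) *
        inverse ((\<Prod>k<5. qprod5 2 (w ^ k * y)) * (\<Prod>k<5. qprod5 3 (w ^ k * y)))"
    by (simp only: rr_G_def rr_H_def prod.distrib prod_inversef [symmetric] inverse_mult_distrib o_def)
  also have "\<dots> = g * h"
  proof -
    have "(\<Prod>k<5. qprod5 j (w ^ k * y)) = qprod5 j x" if "j \<in> {1, 2, 3, 4}" for j
      using prod_qprod5_fifth_roots_unity[OF ny w5 w[OF that]] by (simp only: y)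
    thus ?thesis by (simp only: g_def h_def rr_G_def rr_H_def insert_iff simp_thms)
  qed
  finally have GH: "(\<Prod>k<5. rr_G (w ^ k * y) * rr_H (w ^ k * y)) = g * h" .
  have "1 = (\<Prod>k<5. rr_G (w ^ k * y) * rr_H (w ^ k * y) *
               (g ^ 2 - w ^ k * y * g * h - (w ^ k * y) ^ 2 * h ^ 2))"
    using rr_GH_quintic[OF nwy] by (simp add: pow5 g_def h_def)
  also have "\<dots> = (\<Prod>k<5. rr_G (w ^ k * y) * rr_H (w ^ k * y)) *
                 (\<Prod>k<5. g ^ 2 - w ^ k * y * g * h - (w ^ k * y) ^ 2 * h ^ 2)"
    by (rule prod.distrib)
  also have "(\<lambda>k. g ^ 2 - w ^ k * y * g * h - (w ^ k * y) ^ 2 * h ^ 2) =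
             (\<lambda>k. g ^ 2 - w ^ k * (y * h) * g - (w ^ k * (y * h)) ^ 2)"
    by (simp add: power_mult_distrib mult_ac)
  also have "(\<Prod>k<5. g ^ 2 - w ^ k * (y * h) * g - (w ^ k * (y * h)) ^ 2) =
             g ^ 10 - 11 * (y * h) ^ 5 * g ^ 5 - (y * h) ^ 10"
    by (rule prod_golden_fifth_roots_unity) (use w[of 1] in simp)
  finally have "g * h * (g ^ 10 - 11 * (y * h) ^ 5 * g ^ 5 - (y * h) ^ 10) = 1"
    by (simp only: GH)
  moreover have "g * h * (g ^ 10 - 11 * (y * h) ^ 5 * g ^ 5 - (y * h) ^ 10) =
                 g ^ 11 * h - 11 * y ^ 5 * g ^ 6 * h ^ 6 - (y ^ 5) ^ 2 * g * h ^ 11"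
    by algebra
  ultimately show ?thesis by (simp only: y)
qed

lemma qprod5_has_fps_expansion:
  assumes "m > 0"
  shows "qprod5 m has_fps_expansion fps_expansion (qprod5 m) 0"
  using qpoch_inf_power(3)[OF assms] by (simp add: qprod5_def [abs_def])

text \<open>With v = q h / g, P and Q are the homogenised denominator and numerator of Ramanujan's
  relation between the continued fraction at q and its value v at q^5. In these terms 1 / R^5 will
  be g P / (h Q). The last identity sorts the resulting polynomial by exponents of q modulo
  5.\<close>

lemma quintic_modular_polynomial:
  fixes q g h :: complex
  defines "F \<equiv> g ^ 2 - q * g * h - q ^ 2 * h ^ 2"
  defines "P \<equiv> g ^ 4 + 3 * q * g ^ 3 * h + 4 * q ^ 2 * g ^ 2 * h ^ 2 + 2 * q ^ 3 * g * h ^ 3 + q ^ 4 * h ^ 4"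
  defines "Q \<equiv> g ^ 4 - 2 * q * g ^ 3 * h + 4 * q ^ 2 * g ^ 2 * h ^ 2 - 3 * q ^ 3 * g * h ^ 3 + q ^ 4 * h ^ 4"
  shows "F * P * Q = g ^ 10 - 11 * q ^ 5 * g ^ 5 * h ^ 5 - q ^ 10 * h ^ 10"
    and "(g * P) ^ 2 - 11 * q * (g * P) * (h * Q) - q ^ 2 * (h * Q) ^ 2 = F ^ 5"
    and "(g * P) ^ 2 * F = 
      g ^ 12 - 36 * q ^ 5 * g ^ 7 * h ^ 5 - q ^ 10 * g ^ 2 * h ^ 10 +
      q * (5 * g ^ 11 * h - 40 * q ^ 5 * g ^ 6 * h ^ 6) +
      q ^ 2 * (10 * g ^ 10 * h ^ 2 - 30 * q ^ 5 * g ^ 5 * h ^ 7) +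
      q ^ 3 * (5 * g ^ 9 * h ^ 3 - 15 * q ^ 5 * g ^ 4 * h ^ 8) +
      q ^ 4 * (- 15 * g ^ 8 * h ^ 4 - 5 * q ^ 5 * g ^ 3 * h ^ 9)"
  unfolding F_def P_def Q_def by algebra+

text \<open>The identity is claimed only near 0, since the root of the quadratic equation is
  selected by continuity at q = 0; this suffices for comparing power series.\<close>

lemma inverse_rr_R_power5_dissection:
  "\<forall>\<^sub>F q in nhds 0. 1 / rr_R q ^ 5 = (let x = q ^ 5; g = rr_G x; h = rr_H x in
      g ^ 12 - 36 * x * g ^ 7 * h ^ 5 - x ^ 2 * g ^ 2 * h ^ 10 +
      q * (5 * g ^ 11 * h - 40 * x * g ^ 6 * h ^ 6) +
      q ^ 2 * (10 * g ^ 10 * h ^ 2 - 30 * x * g ^ 5 * h ^ 7) +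
      q ^ 3 * (5 * g ^ 9 * h ^ 3 - 15 * x * g ^ 4 * h ^ 8) +
      q ^ 4 * (- 15 * g ^ 8 * h ^ 4 - 5 * x * g ^ 3 * h ^ 9))"
proof -
  define P where "P = (\<lambda>q g h :: complex. g ^ 4 + 3 * q * g ^ 3 * h + 4 * q ^ 2 * g ^ 2 * h ^ 2 + 2 * q ^ 3 * g * h ^ 3 + q ^ 4 * h ^ 4)"
  define Q where "Q = (\<lambda>q g h :: complex. g ^ 4 - 2 * q * g ^ 3 * h + 4 * q ^ 2 * g ^ 2 * h ^ 2 - 3 * q ^ 3 * g * h ^ 3 + q ^ 4 * h ^ 4)"
  \<comment> \<open>W does not vanish near 0, which excludes the second root of the quadratic equation for 1 / R^5.\<close>
  define W where "W = (\<lambda>q. let g = rr_G (q ^ 5); h = rr_H (q ^ 5) in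
     rr_G q ^ 5 * (g * P q g h) + q ^ 2 * rr_H q ^ 5 * (h * Q q g h))"
  have cont: "isCont (qprod5 m) 0" if "m > 0" for m
    using qprod5_has_fps_expansion[OF that] by (rule has_fps_expansion_imp_continuous)
  have contG: "(rr_G \<longlongrightarrow> 1) (nhds 0)" and contH: "(rr_H \<longlongrightarrow> 1) (nhds 0)"
  proof -
    have *: "(qprod5 m \<longlongrightarrow> 1) (nhds 0)" if "m > 0" for m
      using cont[OF that] qprod5_0[OF that] by (simp add: isCont_def tendsto_nhds_iff)
    have "(rr_G \<longlongrightarrow> inverse (1 * 1)) (nhds 0)" "(rr_H \<longlongrightarrow> inverse (1 * 1)) (nhds 0)"
      unfolding rr_G_def [abs_def] rr_H_def [abs_def] by (intro tendsto_intros *; simp)+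
    thus "(rr_G \<longlongrightarrow> 1) (nhds 0)" "(rr_H \<longlongrightarrow> 1) (nhds 0)" by simp_all
  qed
  have id0: "((\<lambda>q::complex. q) \<longlongrightarrow> 0) (nhds 0)" by (simp add: filterlim_ident)
  have "((\<lambda>q::complex. q ^ 5) \<longlongrightarrow> 0 ^ 5) (nhds 0)" by (intro tendsto_intros id0)
  hence q5: "filterlim (\<lambda>q::complex. q ^ 5) (nhds 0) (nhds 0)" by simp
  note lims = contG contH filterlim_compose[OF contG q5] filterlim_compose[OF contH q5] id0
  have "(W \<longlongrightarrow> 1 ^ 5 * (1 * P 0 1 1) + 0 ^ 2 * 1 ^ 5 * (1 * Q 0 1 1)) (nhds 0)"
    unfolding W_def Let_def P_def Q_def by (intro tendsto_intros lims)
  hence "(W \<longlongrightarrow> 1) (nhds 0)" by (simp add: P_def)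
  hence "\<forall>\<^sub>F q in nhds 0. W q \<noteq> 0" by (rule tendsto_imp_eventually_ne) simp
  moreover have "\<forall>\<^sub>F q::complex in nhds 0. q \<in> ball 0 1"
    by (intro eventually_nhds_in_open) auto
  ultimately show ?thesis
  proof eventually_elim
    case (elim q)
    hence q: "norm q < 1" and x: "norm (q ^ 5) < 1" by (auto simp: norm_power_less_1)
    define g h where "g = rr_G (q ^ 5)" and "h = rr_H (q ^ 5)"
    define F where "F = g ^ 2 - q * g * h - q ^ 2 * h ^ 2"
    define A B where "A = rr_G q ^ 5" and "B = rr_H q ^ 5"
    define \<alpha> \<beta> where "\<alpha> = g * P q g h" and "\<beta> = h * Q q g h"
    have GHF: "rr_G q * rr_H q * F = 1"
      using rr_GH_quintic[OF q] by (simp add: F_def g_def h_def)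
    hence "(rr_G q * rr_H q * F) ^ 5 = 1" by simp
    hence 1: "A * B * F ^ 5 = 1" by (simp only: A_def B_def power_mult_distrib)
    have "rr_G q * rr_H q * (A ^ 2 - 11 * q * A * B - q ^ 2 * B ^ 2) = 1"
      using rr_GH_eq_1[OF q] by (simp add: A_def B_def algebra_simps eval_nat_numeral)
    hence 2: "A ^ 2 - 11 * q * A * B - q ^ 2 * B ^ 2 = F"
      using GHF by algebra
    have "g * h * (F * P q g h * Q q g h) = 1"
      unfolding F_def P_def Q_def quintic_modular_polynomial(1)
      using rr_GH_eq_1[OF x] by (simp add: g_def h_def algebra_simps eval_nat_numeral)
    hence 3: "\<alpha> * \<beta> * F = 1" by (simp add: \<alpha>_def \<beta>_def mult_ac)
    have 4: "\<alpha> ^ 2 - 11 * q * \<alpha> * \<beta> - q ^ 2 * \<beta> ^ 2 = F ^ 5"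
      unfolding \<alpha>_def \<beta>_def F_def P_def Q_def by (rule quintic_modular_polynomial(2))
    \<comment> \<open>Both A / B and \<alpha> / \<beta> satisfy u^2 - (11 q + F^6) u - q^2 = 0.
      Cross-multiplying the two equations removes the linear term; the second factor corresponds to
      the other root - q^2 \<beta> / \<alpha>.\<close>
    have "(A * \<beta> - \<alpha> * B) * (A * \<alpha> + q ^ 2 * B * \<beta>) =
          (A ^ 2 - 11 * q * A * B - q ^ 2 * B ^ 2) * (\<alpha> * \<beta>) - (\<alpha> ^ 2 - 11 * q * \<alpha> * \<beta> - q ^ 2 * \<beta> ^ 2) * (A * B)"
      by (simp add: algebra_simps power2_eq_square)
    also have "\<dots> = 0" unfolding 2 4 using 1 3 by (simp add: mult_ac)
    finally have "(A * \<beta> - \<alpha> * B) * (A * \<alpha> + q ^ 2 * B * \<beta>) = 0" .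
    moreover have "A * \<alpha> + q ^ 2 * B * \<beta> \<noteq> 0"
      using elim by (simp add: W_def Let_def A_def B_def \<alpha>_def \<beta>_def g_def h_def)
    ultimately have "A * \<beta> = \<alpha> * B" by simp
    moreover have "\<beta> \<noteq> 0" using 3 by auto
    moreover have "B \<noteq> 0" using 1 by auto
    ultimately have "A / B = \<alpha> / \<beta>" by (simp add: field_simps)
    \<comment> \<open>Here the quotient turns into a polynomial: \<alpha> \<beta> F = 1 means 1 /
      \<beta> = \<alpha> F.\<close>
    also have "\<dots> = \<alpha> ^ 2 * F" using 3 \<open>\<beta> \<noteq> 0\<close> by (simp add: field_simps power2_eq_square)
    finally have "1 / rr_R q ^ 5 = (g * P q g h) ^ 2 * F"
      by (simp add: A_def B_def \<alpha>_def rr_R_conv_GH power_divide)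
    thus ?case
      unfolding P_def F_def quintic_modular_polynomial(3) by (simp add: Let_def g_def h_def)
  qed
qed

section \<open>Power series with nonnegative coefficients\<close>

definition fps_nonneg :: "complex fps \<Rightarrow> bool" where
  "fps_nonneg F \<longleftrightarrow> (\<forall>n. fps_nth F n \<in> \<real>\<^sub>\<ge>\<^sub>0)"

named_theorems fps_nonneg_intros

lemma fps_nonneg_basic [fps_nonneg_intros]:
  "fps_nonneg 0" "fps_nonneg 1" "fps_nonneg fps_X" "fps_nonneg (numeral k)"
  by (auto simp: fps_nonneg_def fps_X_def fps_numeral_nth)

lemma fps_nonneg_add [fps_nonneg_intros]:
  "fps_nonneg F \<Longrightarrow> fps_nonneg G \<Longrightarrow> fps_nonneg (F + G)"
  by (auto simp: fps_nonneg_def)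

lemma fps_nonneg_mult [fps_nonneg_intros]:
  assumes "fps_nonneg F" "fps_nonneg G"
  shows "fps_nonneg (F * G)"
proof -
  have "(\<Sum>i\<in>A. fps_nth F (f i) * fps_nth G (g i)) \<in> \<real>\<^sub>\<ge>\<^sub>0" if "finite A" for A :: "nat set" and f g
    using that assms by (induction A rule: finite_induct) (auto simp: fps_nonneg_def)
  thus ?thesis by (simp add: fps_nonneg_def fps_mult_nth)
qed

lemma fps_nonneg_power [fps_nonneg_intros]: "fps_nonneg F \<Longrightarrow> fps_nonneg (F ^ n)"
  by (induction n) (auto intro: fps_nonneg_intros)

lemma fps_nonneg_minus_1:
  "fps_nonneg F \<Longrightarrow> fps_nth F 0 = 1 \<Longrightarrow> fps_nonneg (F - 1)"
  by (auto simp: fps_nonneg_def)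

lemma fps_nonneg_limit:
  assumes "\<And>N. fps_nonneg (A N)" "\<And>n. (\<lambda>N. fps_nth (A N) n) \<longlonglongrightarrow> fps_nth F n"
  shows "fps_nonneg F"
  unfolding fps_nonneg_def
  using closed_sequentially[OF closed_nonneg_Reals_complex _ assms(2)] assms(1)
  by (auto simp: fps_nonneg_def)

section \<open>Coefficientwise inequalities between products of geometric series\<close>

definition geom :: "nat \<Rightarrow> complex fps" where
  "geom j = inverse (1 - fps_X ^ j)"

lemma geom_mult: "j > 0 \<Longrightarrow> (1 - fps_X ^ j) * geom j = 1"
  unfolding geom_def by (intro inverse_mult_eq_1') simp

lemma geom_eq: "j > 0 \<Longrightarrow> geom j = 1 + fps_X ^ j * geom j"
  using geom_mult[of j] by (simp add: algebra_simps)

lemma geom_nonneg [fps_nonneg_intros]: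
  assumes "j > 0"
  shows "fps_nonneg (geom j)"
proof -
  have "fps_nth (geom j) n \<in> \<real>\<^sub>\<ge>\<^sub>0" for n
  proof (induction n rule: less_induct)
    case (less n)
    have "fps_nth (geom j) n = fps_nth (1 + fps_X ^ j * geom j) n"
      using geom_eq[OF assms] by simp
    also have "\<dots> = (if n = 0 then 1 else 0) + (if n < j then 0 else fps_nth (geom j) (n - j))"
      by (simp add: fps_X_power_mult_nth)
    finally show ?case using less[of "n - j"] assms by auto
  qed
  thus ?thesis by (simp add: fps_nonneg_def)
qed

lemma geom_1_nth: "fps_nth (geom 1) n = 1"
proof (induction n)
  case (Suc n)
  have "fps_nth (geom 1) (Suc n) = fps_nth (1 + fps_X * geom 1) (Suc n)"
    using geom_eq[of 1] by simp
  thus ?case using Suc by simp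
qed (simp add: geom_def)

text \<open>With y = q^a, (1 - y q) (1 - y q^2) - (1 - y) (1 - y q^3) = y (1 - q) (1 - q^2). The
  multiplier \<open>geom 1 * geom 2\<close> cancels exactly the factors that carry signs.\<close>

lemma geom_block_diff:
  assumes "a > 0"
  shows "fps_nonneg (geom 1 * geom 2 * (geom a * geom (a + 3) - geom (a + 1) * geom (a + 2)))"
proof -
  define q y :: "complex fps" where "q = fps_X" and "y = fps_X ^ a"
  have 1: "(1 - q) * geom 1 = 1" "(1 - q ^ 2) * geom 2 = 1"
    using geom_mult[of 1] geom_mult[of 2] by (simp_all add: q_def)
  have 2: "(1 - y) * geom a = 1" "(1 - y * q) * geom (a + 1) = 1"
       "(1 - y * q ^ 2) * geom (a + 2) = 1" "(1 - y * q ^ 3) * geom (a + 3) = 1"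
    using geom_mult[OF assms] geom_mult[of "a + 1"] geom_mult[of "a + 2"] geom_mult[of "a + 3"] assms
    unfolding q_def y_def power_add power_one_right by (simp_all only: add_gr_0 simp_thms)
  have "geom a * geom (a + 3) - geom (a + 1) * geom (a + 2) =
        ((1 - y * q) * geom (a + 1)) * ((1 - y * q ^ 2) * geom (a + 2)) * (geom a * geom (a + 3)) -
        ((1 - y) * geom a) * ((1 - y * q ^ 3) * geom (a + 3)) * (geom (a + 1) * geom (a + 2))"
    by (simp only: 2 mult_1)
  also have "\<dots> = (1 - q) * (1 - q ^ 2) * (y * geom a * geom (a + 1) * geom (a + 2) * geom (a + 3))"
    by algebra
  finally have "geom 1 * geom 2 * (geom a * geom (a + 3) - geom (a + 1) * geom (a + 2)) =
        ((1 - q) * geom 1) * ((1 - q ^ 2) * geom 2) *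
        (y * geom a * geom (a + 1) * geom (a + 2) * geom (a + 3))"
    by (simp only: mult_ac)
  hence "geom 1 * geom 2 * (geom a * geom (a + 3) - geom (a + 1) * geom (a + 2)) =
        fps_X ^ a * geom a * geom (a + 1) * geom (a + 2) * geom (a + 3)"
    by (simp only: 1 mult_1 y_def)
  thus ?thesis using assms by (auto intro!: fps_nonneg_intros)
qed

text \<open>Telescoping over the blocks: each step changes one block of h into one of g, at a cost
  controlled by \<open>geom_block_diff\<close>. The exponents 1 to 4 are left out because they are
  treated in \<open>geom_first_block\<close>.\<close>

lemma geom_prod_diff:
  defines "g \<equiv> \<lambda>N. \<Prod>k<N. geom (5 * k + 6) * geom (5 * k + 9)"
  defines "h \<equiv> \<lambda>N. \<Prod>k<N. geom (5 * k + 7) * geom (5 * k + 8)"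
  shows "fps_nonneg (g N)" "fps_nonneg (h N)" "fps_nonneg (geom 1 * geom 2 * (g N - h N))"
proof -
  have g: "fps_nonneg (g N)" for N
    unfolding g_def by (induction N) (auto intro!: fps_nonneg_intros)
  have h: "fps_nonneg (h N)" for N
    unfolding h_def by (induction N) (auto intro!: fps_nonneg_intros)
  show "fps_nonneg (g N)" "fps_nonneg (h N)" by (rule g h)+
  show "fps_nonneg (geom 1 * geom 2 * (g N - h N))"
  proof (induction N)
    case 0
    show ?case by (simp add: g_def h_def fps_nonneg_intros)
  next
    case (Suc N)
    define a where "a = 5 * N + 6"
    have a: "g (Suc N) = g N * (geom a * geom (a + 3))" "h (Suc N) = h N * (geom (a + 1) * geom (a + 2))"
      by (simp_all add: g_def h_def a_def numeral_eq_Suc)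
    have "geom 1 * geom 2 * (g (Suc N) - h (Suc N)) =
          geom 1 * geom 2 * (g N - h N) * (geom a * geom (a + 3)) +
          h N * (geom 1 * geom 2 * (geom a * geom (a + 3) - geom (a + 1) * geom (a + 2)))"
      unfolding a by (simp add: algebra_simps)
    moreover have a0: "a > 0" by (simp add: a_def)
    hence "fps_nonneg (geom a * geom (a + 3))"
      by (intro fps_nonneg_intros) auto
    ultimately show ?case
      using fps_nonneg_add[OF fps_nonneg_mult[OF Suc] fps_nonneg_mult[OF h[of N] geom_block_diff[OF a0]]]
      by (simp only:)
  qed
qed

text \<open>
  Since geom 1 = (1 + q + q^2) geom 3 and geom 2 = (1 + q^2) geom 4, this comes down to the
  polynomial (1 + q + q^2)^5 - 3 q (1 + q^2)^5, whose only negative terms (in degrees 9 and 11)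
  are compensated by those in degrees 6 and 8 after one division by 1 - q^3.
\<close>

lemma geom_first_block:
  "fps_nonneg (geom 1 ^ 5 * geom 4 ^ 5 - 3 * fps_X * geom 2 ^ 5 * geom 3 ^ 5)"
proof -
  have "(1 - fps_X) * (geom (Suc 0) - geom 3 * (1 + fps_X + fps_X ^ 2)) = 0"
    using geom_mult[of 1, simplified] geom_mult[of 3, simplified] by algebra
  hence 1: "geom (Suc 0) = geom 3 * (1 + fps_X + fps_X ^ 2)"
    using fps_X_neq_one by auto
  have "(1 - fps_X ^ 2) * (geom 2 - geom 4 * (1 + fps_X ^ 2)) = 0"
    using geom_mult[of 2, simplified] geom_mult[of 4, simplified] by algebra
  moreover have "1 - fps_X ^ 2 \<noteq> (0 :: complex fps)"
    by (metis geom_mult mult_zero_left zero_neq_one zero_less_numeral)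
  ultimately have 2: "geom 2 = geom 4 * (1 + fps_X ^ 2)" by simp
  define q :: "complex fps" where "q = fps_X"
  define c where "c = 1 + 2 * q + 15 * q ^ 2 + 15 * q ^ 3 + 45 * q ^ 4 + 21 * q ^ 5 + 35 * q ^ 6 + 12 * q ^ 8 + q ^ 10"
  have "geom 1 ^ 5 * geom 4 ^ 5 - 3 * q * geom 2 ^ 5 * geom 3 ^ 5 =
        geom 3 ^ 4 * geom 4 ^ 5 * (geom 3 * ((1 + q + q ^ 2) ^ 5 - 3 * q * (1 + q ^ 2) ^ 5))"
    unfolding One_nat_def 1 2 q_def by algebra
  also have "(1 + q + q ^ 2) ^ 5 - 3 * q * (1 + q ^ 2) ^ 5 = c + (1 - q ^ 3) * (10 * q ^ 6 + 3 * q ^ 8)"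
    unfolding c_def by algebra
  also have "geom 3 * \<dots> = geom 3 * c + (1 - q ^ 3) * geom 3 * (10 * q ^ 6 + 3 * q ^ 8)"
    by (simp add: algebra_simps)
  also have "(1 - q ^ 3) * geom 3 = 1" unfolding q_def by (rule geom_mult) simp
  finally show ?thesis
    by (auto simp: c_def q_def intro!: fps_nonneg_intros)
qed

text \<open>With the first block split off, the difference is
  \<open>geom 1 ^ 5 * geom 4 ^ 5 * (g' ^ 5 - h' ^ 5)\<close> plus h'^5 times the difference for the
  first block. In the former, g'^5 - h'^5 has the factor g' - h' and a cofactor without
  signs.\<close>

lemma geom_prod_power5_diff:
  defines "g \<equiv> \<lambda>N. \<Prod>k<N. geom (5 * k + 1) * geom (5 * k + 4)"
  defines "h \<equiv> \<lambda>N. \<Prod>k<N. geom (5 * k + 2) * geom (5 * k + 3)"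
  shows "fps_nonneg (g (Suc N) ^ 5 - 3 * fps_X * h (Suc N) ^ 5)"
proof -
  define g' where "g' = (\<Prod>k<N. geom (5 * k + 6) * geom (5 * k + 9))"
  define h' where "h' = (\<Prod>k<N. geom (5 * k + 7) * geom (5 * k + 8))"
  note gh' = geom_prod_diff[where N = N, folded g'_def h'_def]
  have g: "g (Suc N) = geom 1 * geom 4 * g'" and h: "h (Suc N) = geom 2 * geom 3 * h'"
    unfolding g_def h_def g'_def h'_def prod.lessThan_Suc_shift by (simp_all add: numeral_eq_Suc)
  define D where "D = geom 1 * geom 2 * (g' - h') * (g' ^ 4 + g' ^ 3 * h' + g' ^ 2 * h' ^ 2 + g' * h' ^ 3 + h' ^ 4)"
  have D: "fps_nonneg D"
    unfolding D_def by (rule fps_nonneg_mult[OF gh'(3)]) (intro fps_nonneg_intros gh')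
  \<comment> \<open>The factor \<open>geom 2\<close> required in D does not occur in
    \<open>geom 1 ^ 5 * geom 4 ^ 5\<close>. It is introduced together with 1 - q^2, which one copy
    of \<open>geom 1\<close> absorbs, leaving 1 + q.\<close>
  have "(1 - fps_X ^ 2) * geom 1 = (1 + fps_X) * ((1 - fps_X ^ 1) * geom 1)"
    by algebra
  also have "(1 - fps_X ^ 1) * geom 1 = 1" by (rule geom_mult) simp
  finally have 1: "(1 - fps_X ^ 2) * geom 1 = 1 + fps_X" by (simp only: mult_1_right)
  have "geom 1 ^ 5 * geom 4 ^ 5 * (g' ^ 5 - h' ^ 5) =
        geom 1 ^ 3 * geom 4 ^ 5 * ((1 - fps_X ^ 2) * geom 1) * D"
  proof -
    have "geom 1 ^ 5 * geom 4 ^ 5 * (g' ^ 5 - h' ^ 5) =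
          geom 1 ^ 5 * geom 4 ^ 5 * (g' ^ 5 - h' ^ 5) * ((1 - fps_X ^ 2) * geom 2)"
      using geom_mult[of 2] by simp
    thus ?thesis unfolding D_def by algebra
  qed
  also have "\<dots> = geom 1 ^ 3 * geom 4 ^ 5 * (1 + fps_X) * D"
    by (simp only: 1)
  finally have "g (Suc N) ^ 5 - 3 * fps_X * h (Suc N) ^ 5 =
        geom 1 ^ 3 * geom 4 ^ 5 * (1 + fps_X) * D +
        h' ^ 5 * (geom 1 ^ 5 * geom 4 ^ 5 - 3 * fps_X * geom 2 ^ 5 * geom 3 ^ 5)"
    unfolding g h by (simp add: power_mult_distrib algebra_simps)
  thus ?thesis
    by (simp only:) (intro fps_nonneg_intros D geom_first_block gh'; simp)
qed

text \<open>The factors other than \<open>geom 1\<close> form a series U with nonnegative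
  coefficients and constant term 1, so U - 1 is again nonnegative.\<close>

lemma geom_prod_ge_geom_1:
  "fps_nonneg ((\<Prod>k<Suc N. geom (5 * k + 1) * geom (5 * k + 4)) - geom 1)"
proof -
  define U where "U = geom 4 * (\<Prod>k<N. geom (5 * k + 6) * geom (5 * k + 9))"
  have "(\<Prod>k<Suc N. geom (5 * k + 1) * geom (5 * k + 4)) - geom 1 = geom 1 * (U - 1)"
    unfolding U_def prod.lessThan_Suc_shift by (simp add: algebra_simps)
  moreover have "fps_nth (\<Prod>k<N. geom (5 * k + 6) * geom (5 * k + 9)) 0 = 1"
    by (induction N) (auto simp: geom_def)
  hence "fps_nonneg (U - 1)"
    unfolding U_def by (intro fps_nonneg_minus_1 fps_nonneg_intros geom_prod_diff) (auto simp: geom_def)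
  ultimately show ?thesis by (auto intro!: fps_nonneg_intros)
qed

section \<open>Passage from finite products to the power series of G and H\<close>

lemma qprod5_uniform_limit:
  assumes "m > 0"
  shows "uniform_limit (ball 0 (1 / 2)) (\<lambda>N q. \<Prod>k<N. 1 - q ^ m * (q ^ 5) ^ k) (qprod5 m) sequentially"
proof -
  define f where "f = (\<lambda>k (q :: complex). 1 - q ^ m * (q ^ 5) ^ k)"
  have bound: "norm (f k q - 1) \<le> (1 / 2) ^ k" if "q \<in> cball 0 (1 / 2)" for k q
  proof -
    have "norm (f k q - 1) = norm q ^ (m + 5 * k)"
      by (simp add: f_def norm_mult norm_power power_add power_mult)
    also have "\<dots> \<le> (1 / 2) ^ (m + 5 * k)" using that by (intro power_mono) auto
    also have "\<dots> \<le> (1 / 2) ^ k" by (intro power_decreasing) auto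
    finally show ?thesis .
  qed
  have "uniformly_convergent_on (cball 0 (1 / 2)) (\<lambda>N q. \<Sum>k<N. norm (f k q - 1))"
    using bound
    by (intro Weierstrass_m_test'[where M = "\<lambda>k. (1 / 2) ^ k"]) (auto intro!: summable_geometric)
  hence "uniformly_convergent_on (cball 0 (1 / 2)) (\<lambda>N q. \<Prod>k<N. f k q)"
    by (intro uniformly_convergent_on_prod') (auto simp: f_def intro!: continuous_intros)
  then obtain l where l: "uniform_limit (cball 0 (1 / 2)) (\<lambda>N q. \<Prod>k<N. f k q) l sequentially"
    by (auto simp: uniformly_convergent_on_def)
  have "l q = qprod5 m q" if "q \<in> cball 0 (1 / 2)" for q
  proof (rule LIMSEQ_unique)
    show "(\<lambda>N. \<Prod>k<N. f k q) \<longlonglongrightarrow> l q"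
      using tendsto_uniform_limitI[OF l that] .
    show "(\<lambda>N. \<Prod>k<N. f k q) \<longlonglongrightarrow> qprod5 m q"
      unfolding f_def qprod5_def using that
      by (intro qpoch_inf_LIMSEQ norm_power_less_1) auto
  qed
  hence "uniform_limit (cball 0 (1 / 2)) (\<lambda>N q. \<Prod>k<N. f k q) (qprod5 m) sequentially"
    using l by (subst (asm) uniform_limit_cong') auto
  thus ?thesis
    unfolding f_def by (rule uniform_limit_on_subset) auto
qed

text \<open>Uniform convergence of holomorphic functions near 0 carries over to their derivatives at
  0, hence to Taylor coefficients.\<close>

lemma qprod5_fps_nth_LIMSEQ:
  assumes "m > 0"
  shows "(\<lambda>N. fps_nth (\<Prod>k<N. 1 - fps_X ^ (m + 5 * k)) n) \<longlonglongrightarrow> fps_nth (fps_expansion (qprod5 m) 0) n"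
proof -
  define f where "f = (\<lambda>N (q :: complex). \<Prod>k<N. 1 - q ^ m * (q ^ 5) ^ k)"
  have exp: "f N has_fps_expansion (\<Prod>k<N. 1 - fps_X ^ (m + 5 * k))" for N
    unfolding f_def power_add power_mult by (intro fps_expansion_intros)
  have "(\<lambda>N. (deriv ^^ n) (f N) 0) \<longlonglongrightarrow> (deriv ^^ n) (qprod5 m) 0"
  proof (rule higher_deriv_complex_uniform_limit[where A = "ball 0 (1 / 2)"])
    show "uniform_limit (ball 0 (1 / 2)) f (qprod5 m) sequentially"
      unfolding f_def by (rule qprod5_uniform_limit[OF assms])
    show "\<forall>\<^sub>F N in sequentially. f N holomorphic_on ball 0 (1 / 2)"
      unfolding f_def by (intro always_eventually allI holomorphic_intros)
  qed auto
  hence "(\<lambda>N. (deriv ^^ n) (f N) 0 / fact n) \<longlonglongrightarrow> (deriv ^^ n) (qprod5 m) 0 / fact n"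
    by (intro tendsto_intros) auto
  thus ?thesis
    by (simp add: fps_nth_fps_expansion[OF exp] fps_nth_fps_expansion[OF qprod5_has_fps_expansion[OF assms]])
qed

lemma fps_mult_nth_LIMSEQ:
  fixes A B :: "nat \<Rightarrow> complex fps"
  assumes "\<And>n. (\<lambda>N. fps_nth (A N) n) \<longlonglongrightarrow> fps_nth F n" "\<And>n. (\<lambda>N. fps_nth (B N) n) \<longlonglongrightarrow> fps_nth G n"
  shows "(\<lambda>N. fps_nth (A N * B N) n) \<longlonglongrightarrow> fps_nth (F * G) n"
  unfolding fps_mult_nth by (intro tendsto_intros assms)

lemma fps_power_nth_LIMSEQ:
  fixes A :: "nat \<Rightarrow> complex fps"
  assumes "\<And>n. (\<lambda>N. fps_nth (A N) n) \<longlonglongrightarrow> fps_nth F n"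
  shows "(\<lambda>N. fps_nth (A N ^ k) n) \<longlonglongrightarrow> fps_nth (F ^ k) n"
  by (induction k arbitrary: n) (auto intro!: fps_mult_nth_LIMSEQ assms)

text \<open>A coefficient of the inverse is a polynomial in finitely many coefficients of the series
  and earlier ones of the inverse, so limits pass through the recursion.\<close>

lemma fps_inverse_nth_LIMSEQ:
  fixes A :: "nat \<Rightarrow> complex fps"
  assumes "\<And>n. (\<lambda>N. fps_nth (A N) n) \<longlonglongrightarrow> fps_nth F n"
    and "\<And>N. fps_nth (A N) 0 = 1" "fps_nth F 0 = 1"
  shows "(\<lambda>N. fps_nth (inverse (A N)) n) \<longlonglongrightarrow> fps_nth (inverse F) n"
proof (induction n rule: less_induct)
  case (less n)
  have rec: "fps_nth (inverse F) n = (if n = 0 then 1 else - (\<Sum>i = 1..n. fps_nth F i * fps_nth (inverse F) (n - i)))"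
    if "fps_nth F 0 = 1" for F :: "complex fps"
  proof -
    have "fps_nth (F * inverse F) n = (if n = 0 then 1 else 0)"
      using that by (subst inverse_mult_eq_1') auto
    moreover have "fps_nth (F * inverse F) n =
        fps_nth (inverse F) n + (\<Sum>i = 1..n. fps_nth F i * fps_nth (inverse F) (n - i))"
      unfolding fps_mult_nth by (subst sum.atLeast_Suc_atMost) (simp_all add: that)
    ultimately show ?thesis by (cases "n = 0") (simp_all add: eq_neg_iff_add_eq_0)
  qed
  show ?case
  proof (cases "n = 0")
    case False
    have "(\<lambda>N. - (\<Sum>i = 1..n. fps_nth (A N) i * fps_nth (inverse (A N)) (n - i))) \<longlonglongrightarrow>
          - (\<Sum>i = 1..n. fps_nth F i * fps_nth (inverse F) (n - i))"
      by (intro tendsto_intros assms less) auto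
    thus ?thesis using False by (simp add: rec assms(2,3))
  qed (simp add: assms)
qed

definition fps_G :: "complex fps" where
  "fps_G = inverse (fps_expansion (qprod5 1) 0 * fps_expansion (qprod5 4) 0)"

definition fps_H :: "complex fps" where
  "fps_H = inverse (fps_expansion (qprod5 2) 0 * fps_expansion (qprod5 3) 0)"

lemma fps_expansion_qprod5_0: "m > 0 \<Longrightarrow> fps_nth (fps_expansion (qprod5 m) 0) 0 = 1"
  using qpoch_inf_power(5)[of m] by (simp add: qprod5_def [abs_def])

lemma rr_G_has_fps_expansion: "rr_G has_fps_expansion fps_G"
  and rr_H_has_fps_expansion: "rr_H has_fps_expansion fps_H"
  unfolding rr_G_def [abs_def] rr_H_def [abs_def] fps_G_def fps_H_def
  by (intro fps_expansion_intros qprod5_has_fps_expansion; simp add: fps_expansion_qprod5_0)+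

lemma fps_GH_0: "fps_nth fps_G 0 = 1" "fps_nth fps_H 0 = 1"
  by (simp_all add: fps_G_def fps_H_def fps_expansion_qprod5_0)

lemma geom_prod_LIMSEQ:
  assumes "i > 0" "j > 0"
  shows "(\<lambda>N. fps_nth (\<Prod>k<N. geom (5 * k + i) * geom (5 * k + j)) n) \<longlonglongrightarrow>
         fps_nth (inverse (fps_expansion (qprod5 i) 0 * fps_expansion (qprod5 j) 0)) n"
proof -
  have "(\<Prod>k<N. geom (5 * k + i) * geom (5 * k + j)) =
        inverse ((\<Prod>k<N. 1 - fps_X ^ (i + 5 * k)) * (\<Prod>k<N. 1 - fps_X ^ (j + 5 * k)))" for N
    by (induction N) (simp_all add: geom_def fps_inverse_mult add.commute mult_ac)
  moreover have "fps_nth (\<Prod>k<N. 1 - fps_X ^ (m + 5 * k)) 0 = (1 :: complex)" if "m > 0" for m N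
    using that by (induction N) auto
  ultimately show ?thesis
    using assms
    by (auto simp: fps_expansion_qprod5_0 simp del: fps_inverse_mult
             intro!: fps_inverse_nth_LIMSEQ fps_mult_nth_LIMSEQ qprod5_fps_nth_LIMSEQ)
qed

lemmas fps_G_LIMSEQ = geom_prod_LIMSEQ[of 1 4, folded fps_G_def, OF zero_less_one zero_less_numeral]
lemmas fps_H_LIMSEQ = geom_prod_LIMSEQ[of 2 3, folded fps_H_def, OF zero_less_numeral zero_less_numeral]

lemma fps_GH_nonneg [fps_nonneg_intros]: "fps_nonneg fps_G" "fps_nonneg fps_H"
proof -
  have "fps_nonneg (\<Prod>k<N. geom (5 * k + i) * geom (5 * k + j))" if "i > 0" "j > 0" for i j N
    using that by (induction N) (auto intro!: fps_nonneg_intros)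
  from fps_nonneg_limit[OF this[of 1 4] fps_G_LIMSEQ] fps_nonneg_limit[OF this[of 2 3] fps_H_LIMSEQ]
  show "fps_nonneg fps_G" "fps_nonneg fps_H" by (simp_all only: zero_less_one zero_less_numeral)
qed

lemma fps_G_ge_geom_1: "fps_nonneg (fps_G - geom 1)"
proof (rule fps_nonneg_limit[OF geom_prod_ge_geom_1])
  show "(\<lambda>N. fps_nth ((\<Prod>k<Suc N. geom (5 * k + 1) * geom (5 * k + 4)) - geom 1) n)
          \<longlonglongrightarrow> fps_nth (fps_G - geom 1) n" for n
    unfolding fps_sub_nth by (intro tendsto_intros LIMSEQ_Suc) (use fps_G_LIMSEQ in simp)
qed

lemma fps_G_power5_ge: "fps_nonneg (fps_G ^ 5 - 3 * fps_X * fps_H ^ 5)"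
proof (rule fps_nonneg_limit[OF geom_prod_power5_diff])
  have const: "(\<lambda>N. fps_nth F n) \<longlonglongrightarrow> fps_nth F n" for F :: "complex fps" and n
    by (rule tendsto_const)
  have "(\<lambda>N. fps_nth (\<Prod>k<Suc N. geom (5 * k + 1) * geom (5 * k + 4)) n) \<longlonglongrightarrow> fps_nth fps_G n"
       "(\<lambda>N. fps_nth (\<Prod>k<Suc N. geom (5 * k + 2) * geom (5 * k + 3)) n) \<longlonglongrightarrow> fps_nth fps_H n" for n
    using LIMSEQ_Suc[OF fps_G_LIMSEQ[of n]] LIMSEQ_Suc[OF fps_H_LIMSEQ[of n]] by simp_all
  thus "(\<lambda>N. fps_nth ((\<Prod>k<Suc N. geom (5 * k + 1) * geom (5 * k + 4)) ^ 5 -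
                 3 * fps_X * (\<Prod>k<Suc N. geom (5 * k + 2) * geom (5 * k + 3)) ^ 5) n)
          \<longlonglongrightarrow> fps_nth (fps_G ^ 5 - 3 * fps_X * fps_H ^ 5) n" for n
    unfolding fps_sub_nth by (intro tendsto_diff fps_mult_nth_LIMSEQ fps_power_nth_LIMSEQ const)
qed

text \<open>One factor G dominates \<open>geom 1\<close> and the remaining factors have constant
  term 1. At least one G is needed, as powers of H have no term in q.\<close>

lemma fps_GH_ge_geom_1: "fps_nonneg (fps_G ^ Suc a * fps_H ^ b - geom 1)"
proof -
  have "fps_G ^ Suc a * fps_H ^ b - geom 1 =
        (fps_G - geom 1) * (fps_G ^ a * fps_H ^ b) + geom 1 * (fps_G ^ a * fps_H ^ b - 1)"
    by (simp add: algebra_simps)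
  moreover have "fps_nonneg (fps_G ^ a * fps_H ^ b - 1)"
    by (intro fps_nonneg_minus_1 fps_nonneg_intros) (simp add: fps_GH_0 fps_nth_power_0)
  ultimately show ?thesis
    by (simp only:) (intro fps_nonneg_intros fps_G_ge_geom_1; simp)
qed

lemma fps_GH_eq_1:
  "fps_G ^ 11 * fps_H - 11 * fps_X * fps_G ^ 6 * fps_H ^ 6 - fps_X ^ 2 * fps_G * fps_H ^ 11 = 1"
proof (rule fps_expansion_unique_complex)
  note [fps_expansion_intros] = rr_G_has_fps_expansion rr_H_has_fps_expansion
  show "(\<lambda>x. rr_G x ^ 11 * rr_H x - 11 * x * rr_G x ^ 6 * rr_H x ^ 6 - x ^ 2 * rr_G x * rr_H x ^ 11)
          has_fps_expansion
        fps_G ^ 11 * fps_H - 11 * fps_X * fps_G ^ 6 * fps_H ^ 6 - fps_X ^ 2 * fps_G * fps_H ^ 11"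
    by (intro fps_expansion_intros)
  have "\<forall>\<^sub>F x in nhds 0. x \<in> ball (0 :: complex) 1"
    by (intro eventually_nhds_in_open) auto
  hence "\<forall>\<^sub>F x in nhds 0. 1 = rr_G x ^ 11 * rr_H x - 11 * x * rr_G x ^ 6 * rr_H x ^ 6 -
                                x ^ 2 * rr_G x * rr_H x ^ 11"
    by eventually_elim (use rr_GH_eq_1 in auto)
  thus "(\<lambda>x. rr_G x ^ 11 * rr_H x - 11 * x * rr_G x ^ 6 * rr_H x ^ 6 - x ^ 2 * rr_G x * rr_H x ^ 11)
          has_fps_expansion 1"
    by (rule iffD1[OF has_fps_expansion_cong[OF _ refl] has_fps_expansion_1])
qed

section \<open>Extraction of the components and their signs\<close>

lemma fps_nth_dissection:
  fixes F :: "nat \<Rightarrow> complex fps"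
  assumes "s < d"
  shows "fps_nth (\<Sum>r<d. fps_X ^ r * (F r oo fps_X ^ d)) (d * n + s) = fps_nth (F s) n"
proof -
  have "fps_nth (fps_X ^ r * (F r oo fps_X ^ d)) (d * n + s) = (if r = s then fps_nth (F s) n else 0)"
    if "r < d" for r
  proof (cases "r = s \<or> d * n + s < r")
    case True
    thus ?thesis using assms that by (auto simp: fps_X_power_mult_nth fps_nth_compose_X_power)
  next
    case False
    have "\<not> d dvd (d * n + s - r)"
    proof
      assume "d dvd (d * n + s - r)"
      then obtain t where "d * n + s - r = d * t" by (elim dvdE)
      hence "d * n + s = d * t + r" using False by linarith
      hence "(d * n + s) mod d = (d * t + r) mod d" by simp
      thus False using assms that False by simp
    qed
    thus ?thesis using False by (simp add: fps_X_power_mult_nth fps_nth_compose_X_power)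
  qed
  hence "fps_nth (\<Sum>r<d. fps_X ^ r * (F r oo fps_X ^ d)) (d * n + s) =
         (\<Sum>r<d. if r = s then fps_nth (F s) n else 0)"
    unfolding fps_sum_nth by (intro sum.cong) auto
  thus ?thesis using assms by simp
qed

text \<open>Entry r is the series in x = q^5 that accompanies q^r in the 5-dissection, so its
  coefficients are A(5 n + r).\<close>

definition rr_component :: "nat \<Rightarrow> complex fps" where
  "rr_component r =
     [fps_G ^ 12 - 36 * fps_X * fps_G ^ 7 * fps_H ^ 5 - fps_X ^ 2 * fps_G ^ 2 * fps_H ^ 10,
      5 * fps_G ^ 11 * fps_H - 40 * fps_X * fps_G ^ 6 * fps_H ^ 6,
      10 * fps_G ^ 10 * fps_H ^ 2 - 30 * fps_X * fps_G ^ 5 * fps_H ^ 7,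
      5 * fps_G ^ 9 * fps_H ^ 3 - 15 * fps_X * fps_G ^ 4 * fps_H ^ 8,
      - 15 * fps_G ^ 8 * fps_H ^ 4 - 5 * fps_X * fps_G ^ 3 * fps_H ^ 9] ! r"

lemma rr_A_dissection:
  assumes "s < 5"
  shows "of_int (rr_A (5 * n + s)) = fps_nth (rr_component s) n"
proof -
  have unit: "\<forall>\<^sub>F q in nhds 0. q \<in> ball (0 :: complex) 1"
    by (intro eventually_nhds_in_open) auto
  have A: "(\<lambda>q. 1 / rr_R q ^ 5) has_fps_expansion Abs_fps (\<lambda>n. of_int (rr_A n))"
  proof (rule has_fps_expansionI)
    show "\<forall>\<^sub>F q in nhds 0. (\<lambda>n. fps_nth (Abs_fps (\<lambda>n. of_int (rr_A n))) n * q ^ n) sums (1 / rr_R q ^ 5)"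
      using unit by eventually_elim (use rr_A_sums in auto)
  qed
  note [fps_expansion_intros] = rr_G_has_fps_expansion rr_H_has_fps_expansion
  define c where "c = (\<lambda>r x.
     [rr_G x ^ 12 - 36 * x * rr_G x ^ 7 * rr_H x ^ 5 - x ^ 2 * rr_G x ^ 2 * rr_H x ^ 10,
      5 * rr_G x ^ 11 * rr_H x - 40 * x * rr_G x ^ 6 * rr_H x ^ 6,
      10 * rr_G x ^ 10 * rr_H x ^ 2 - 30 * x * rr_G x ^ 5 * rr_H x ^ 7,
      5 * rr_G x ^ 9 * rr_H x ^ 3 - 15 * x * rr_G x ^ 4 * rr_H x ^ 8,
      - 15 * rr_G x ^ 8 * rr_H x ^ 4 - 5 * x * rr_G x ^ 3 * rr_H x ^ 9] ! r)"
  have c: "c r has_fps_expansion rr_component r" if "r < 5" for r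
  proof -
    from that have "r \<in> {0, 1, 2, 3, 4}" by auto
    thus ?thesis
      by (elim insertE; (simp add: c_def rr_component_def; intro fps_expansion_intros)?)
  qed
  have "(\<lambda>q. q ^ r * c r (q ^ 5)) has_fps_expansion fps_X ^ r * (rr_component r oo fps_X ^ 5)" if "r < 5" for r
  proof -
    have "(c r \<circ> (\<lambda>q. q ^ 5)) has_fps_expansion (rr_component r oo fps_X ^ 5)"
      by (intro has_fps_expansion_compose c that fps_expansion_intros) auto
    thus ?thesis by (intro fps_expansion_intros) (simp add: o_def)
  qed
  hence "(\<lambda>q. \<Sum>r<5. q ^ r * c r (q ^ 5)) has_fps_expansion
           (\<Sum>r<5. fps_X ^ r * (rr_component r oo fps_X ^ 5))"
    by (intro has_fps_expansion_sum) auto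
  moreover have "\<forall>\<^sub>F q in nhds 0. 1 / rr_R q ^ 5 = (\<Sum>r<5. q ^ r * c r (q ^ 5))"
    using inverse_rr_R_power5_dissection
    by eventually_elim (simp add: Let_def c_def numeral_eq_Suc algebra_simps)
  ultimately have "(\<lambda>q. 1 / rr_R q ^ 5) has_fps_expansion
           (\<Sum>r<5. fps_X ^ r * (rr_component r oo fps_X ^ 5))"
    by (subst has_fps_expansion_cong[OF _ refl])
  from fps_expansion_unique_complex[OF A this]
  have "of_int (rr_A (5 * n + s)) = fps_nth (\<Sum>r<5. fps_X ^ r * (rr_component r oo fps_X ^ 5)) (5 * n + s)"
    by (metis fps_nth_Abs_fps)
  thus ?thesis by (simp only: fps_nth_dissection[OF assms])
qed

lemma pos_if_fps_ge_geom_1: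
  assumes "fps_nonneg (F - geom 1)" "of_int a = c * fps_nth F n" "c \<in> \<real>\<^sub>\<ge>\<^sub>0" "c \<noteq> 0"
  shows "a > 0"
proof -
  from assms(1) have "fps_nth F n - 1 \<in> \<real>\<^sub>\<ge>\<^sub>0"
    by (metis fps_nonneg_def fps_sub_nth geom_1_nth)
  then obtain t where t: "fps_nth F n = of_real (1 + t)" "t \<ge> 0"
    by (elim nonneg_Reals_cases) (auto simp: algebra_simps)
  obtain u where u: "c = of_real u" "u > 0"
    using assms(3,4) by (elim nonneg_Reals_cases) (auto simp: order_less_le)
  have "complex_of_real (of_int a) = of_real (u * (1 + t))"
    using assms(2) t u by simp
  hence "of_int a = u * (1 + t)" by (simp only: of_real_eq_iff)
  also have "\<dots> > 0" using t u by (intro mult_pos_pos) auto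
  finally show ?thesis by simp
qed

theorem theorem1p2:
  fixes n :: nat
  shows "rr_A (5 * n + 1) > 0 \<and> rr_A (5 * n + 2) > 0 \<and>
         rr_A (5 * n + 3) > 0 \<and> rr_A (5 * n + 4) < 0"
proof (intro conjI)
  have geom1: "geom 1 = 1 + fps_X * geom 1" using geom_eq[of 1] by simp
  define Z where "Z = fps_G ^ 5 - 3 * fps_X * fps_H ^ 5"
  have Z: "fps_nonneg (Z - 1)"
    using fps_G_power5_ge by (intro fps_nonneg_minus_1) (simp_all add: Z_def fps_GH_0 fps_nth_power_0)
  \<comment> \<open>Since Z - 1 is nonnegative, multiplication by Z preserves the lower bound
    \<open>geom 1\<close> that the factor G provides.\<close>
  have Z_mult: "fps_nonneg (fps_G ^ Suc a * fps_H ^ b * Z - geom 1)" for a b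
  proof -
    have "fps_G ^ Suc a * fps_H ^ b * Z - geom 1 =
          fps_G ^ Suc a * fps_H ^ b * (Z - 1) + (fps_G ^ Suc a * fps_H ^ b - geom 1)"
      by (simp add: algebra_simps)
    thus ?thesis by (simp only:) (intro fps_nonneg_intros Z fps_GH_ge_geom_1)
  qed

  define Q where "Q = 1 + 3 * fps_X * fps_G ^ 6 * fps_H ^ 6 + fps_X ^ 2 * fps_G * fps_H ^ 11"
  \<comment> \<open>The constant 1 in Q pays for the constant term of \<open>geom 1\<close>; the
    rest of \<open>geom 1\<close>, shifted by one degree, is dominated by one of the three copies of
    q G^6 H^6.\<close>
  have "Q - geom 1 = fps_X * ((fps_G ^ Suc 5 * fps_H ^ 6 - geom 1) + 2 * fps_G ^ 6 * fps_H ^ 6) +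
                     fps_X ^ 2 * fps_G * fps_H ^ 11"
    unfolding Q_def by (subst geom1) (simp add: algebra_simps)
  hence "fps_nonneg (Q - geom 1)"
    by (simp only:) (intro fps_nonneg_intros fps_GH_ge_geom_1)
  moreover have "rr_component 1 = 5 * Q"
    using fps_GH_eq_1 unfolding rr_component_def Q_def by simp algebra
  hence "of_int (rr_A (5 * n + 1)) = 5 * fps_nth Q n"
    using rr_A_dissection[of 1 n] by simp
  ultimately show "rr_A (5 * n + 1) > 0"
    by (rule pos_if_fps_ge_geom_1) auto

  have "rr_component 2 = 10 * (fps_G ^ Suc 4 * fps_H ^ 2 * Z)"
    unfolding rr_component_def Z_def by simp algebra
  hence "of_int (rr_A (5 * n + 2)) = 10 * fps_nth (fps_G ^ Suc 4 * fps_H ^ 2 * Z) n"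
    using rr_A_dissection[of 2 n] by simp
  thus "rr_A (5 * n + 2) > 0"
    by (rule pos_if_fps_ge_geom_1[OF Z_mult]) auto

  have "rr_component 3 = 5 * (fps_G ^ Suc 3 * fps_H ^ 3 * Z)"
    unfolding rr_component_def Z_def by simp algebra
  hence "of_int (rr_A (5 * n + 3)) = 5 * fps_nth (fps_G ^ Suc 3 * fps_H ^ 3 * Z) n"
    using rr_A_dissection[of 3 n] by simp
  thus "rr_A (5 * n + 3) > 0"
    by (rule pos_if_fps_ge_geom_1[OF Z_mult]) auto

  define W where "W = 3 * (fps_G ^ 8 * fps_H ^ 4) + fps_X * fps_G ^ 3 * fps_H ^ 9"
  \<comment> \<open>One of the three copies of G^8 H^4 suffices to dominate
    \<open>geom 1\<close>.\<close>
  have "W - geom 1 = (fps_G ^ Suc 7 * fps_H ^ 4 - geom 1) +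
                     (2 * (fps_G ^ 8 * fps_H ^ 4) + fps_X * fps_G ^ 3 * fps_H ^ 9)"
    unfolding W_def by (simp add: algebra_simps)
  hence "fps_nonneg (W - geom 1)"
    by (simp only:) (intro fps_nonneg_intros fps_GH_ge_geom_1)
  moreover have "rr_component 4 = - (5 * W)"
    unfolding rr_component_def W_def by (simp add: algebra_simps)
  hence "of_int (- rr_A (5 * n + 4)) = 5 * fps_nth W n"
    using rr_A_dissection[of 4 n] by simp
  ultimately have "- rr_A (5 * n + 4) > 0"
    by (rule pos_if_fps_ge_geom_1) auto
  thus "rr_A (5 * n + 4) < 0" by simp
qed

end
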